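(* Let $\delta=(\lambda,v)$ be a nondegenerate tangent to the symmetrized bidisc $G$ such that $\Phi_\omega$ solves $\mathrm{Car}\,\delta$ for a unique value of $\omega$ in $\mathbb{T}$, and let $\omega$ denote this value. If $\psi$ solves $\mathrm{Car}\,\delta$, then there exists an automorphism $m$ of $\mathbb{D}$ such that $\psi=m\circ\Phi_\omega$.
   Context: $\mathbb{D}$ is the open unit disc in $\mathbb{C}$ and $\mathbb{T}$ is the unit circle. The symmetrized bidisc is the domain $G=\{(z+w,zw): |z|<1,\ |w|<1\}\subset\mathbb{C}^2$, with coordinates $(s^1,s^2)$ (superscripts are indices). A tangent to $G$ is a pair $\delta=(\lambda,v)$ with $\lambda\in G$ and $v\in\mathbb{C}^2$; it is nondegenerate if $v\neq 0$. $\mathbb{D}(G)$ is the set of holomorphic maps from $G$ to $\mathbb{D}$. For $F\in\mathbb{D}(G)$, $D_vF(\lambda)$ is the complex directional derivative $v_1\,\partial F/\partial s^1(\lambda)+v_2\,\partial F/\partial s^2(\lambda)$. Define $$|\delta|_{\rm car}=\sup_{F\in\mathbb{D}(G)}\frac{|D_vF(\lambda)|}{1-|F(\lambda)|^2}.$$ A function $F\in\mathbb{D}(G)$ is said to solve the Carathéodory extremal problem $\mathrm{Car}\,\delta$ if this supremum is attained at $F$. For $\omega\in\mathbb{T}$, $\Phi_\omega\in\mathbb{D}(G)$ is the function $\Phi_\omega(s^1,s^2)=\dfrac{2\omega s^2-s^1}{2-\omega s^1}$. An automorphism of $\mathbb{D}$ is a biholomorphic self-map of $\mathbb{D}$. 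*)

theory Defs
  imports "HOL-Analysis.Analysis"
begin

definition symmetrized_bidisc :: "(complex \<times> complex) set" where
  "symmetrized_bidisc = {(z + w, z * w) | z w. z \<in> ball 0 1 \<and> w \<in> ball 0 1}"

(* Complex differentiability in two variables: the real Frechet derivative is complex linear.
   Intended for open S only, since the derivative is taken in a full neighbourhood of p. *)
definition holomorphic2_on :: "(complex \<times> complex \<Rightarrow> complex) \<Rightarrow> (complex \<times> complex) set \<Rightarrow> bool"
    (infixl "holomorphic2'_on" 50) where
  "F holomorphic2_on S \<longleftrightarrow>
     (\<forall>p\<in>S. \<exists>a b. (F has_derivative (\<lambda>h. a * fst h + b * snd h)) (at p))"

(* Members are total functions; their values outside S are arbitrary. *)
definition disc_maps :: "(complex \<times> complex) set \<Rightarrow> (complex \<times> complex \<Rightarrow> complex) set" where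
  "disc_maps S = {F. F holomorphic2_on S \<and> F \<in> S \<rightarrow> ball 0 1}"

definition directional_deriv ::
    "complex \<times> complex \<Rightarrow> (complex \<times> complex \<Rightarrow> complex) \<Rightarrow> complex \<times> complex \<Rightarrow> complex" where
  "directional_deriv v F p =
     fst v * deriv (\<lambda>s. F (s, snd p)) (fst p) + snd v * deriv (\<lambda>s. F (fst p, s)) (snd p)"

type_synonym tangent = "(complex \<times> complex) \<times> (complex \<times> complex)"

definition tangents :: "(complex \<times> complex) set \<Rightarrow> tangent set" where
  "tangents S = {(p, v). p \<in> S}"

definition nondegenerate :: "tangent \<Rightarrow> bool" where
  "nondegenerate \<delta> \<longleftrightarrow> snd \<delta> \<noteq> 0"

definition car_quotient :: "(complex \<times> complex \<Rightarrow> complex) \<Rightarrow> tangent \<Rightarrow> real" where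
  "car_quotient F \<delta> =
     norm (directional_deriv (snd \<delta>) F (fst \<delta>)) / (1 - (norm (F (fst \<delta>)))\<^sup>2)"

(* Taken in the extended reals, so that the supremum is meaningful without a boundedness proof. *)
definition car_norm :: "(complex \<times> complex) set \<Rightarrow> tangent \<Rightarrow> ereal" where
  "car_norm S \<delta> = (SUP F \<in> disc_maps S. ereal (car_quotient F \<delta>))"

definition solves_Car ::
    "(complex \<times> complex) set \<Rightarrow> (complex \<times> complex \<Rightarrow> complex) \<Rightarrow> tangent \<Rightarrow> bool" where
  "solves_Car S F \<delta> \<longleftrightarrow> F \<in> disc_maps S \<and> ereal (car_quotient F \<delta>) = car_norm S \<delta>"

definition Phi :: "complex \<Rightarrow> complex \<times> complex \<Rightarrow> complex" where
  "Phi \<omega> = (\<lambda>(s1, s2). (2 * \<omega> * s2 - s1) / (2 - \<omega> * s1))"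

definition disc_automorphism :: "(complex \<Rightarrow> complex) \<Rightarrow> bool" where
  "disc_automorphism m \<longleftrightarrow>
     bij_betw m (ball 0 1) (ball 0 1) \<and> m holomorphic_on ball 0 1 \<and>
     inv_into (ball 0 1) m holomorphic_on ball 0 1"

end

theory Submission
  imports Defs "HOL-Complex_Analysis.Complex_Analysis"
begin

text \<open>
  The Cayley transforms \<open>X = (1 + \<omega> z) / (1 - \<omega> z)\<close> of the two roots \<open>z\<close> of a point of the
  symmetrized bidisc range over the right half-plane. In the coordinates
  \<open>x = (X\<^sub>1 + X\<^sub>2) / 2\<close> and \<open>q = ((X\<^sub>1 - X\<^sub>2) / 2)\<^sup>2\<close> the function \<open>\<Phi>\<^sub>\<omega>\<close> is a Cayley transform of \<open>x\<close>,
  and the other \<open>\<Phi>\<^sub>\<eta>\<close> come from \<open>(x - \<i>\<tau>) / ((x - \<i>\<tau>)\<^sup>2 - q)\<close> with real \<open>\<tau>\<close>. Normalize the base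
  point to \<open>x = 1\<close>. If \<open>\<Phi>\<^sub>\<omega>\<close> beats every other \<open>\<Phi>\<^sub>\<eta>\<close> in the direction \<open>(1, q')\<close>, then
  \<open>q' = 2\<gamma> + \<i>\<beta>\<close> with \<open>\<beta> = Im q\<close>, where the disc \<open>x \<mapsto> (x, \<gamma> x\<^sup>2 + \<i>\<beta> x - \<alpha>)\<close> through the base
  point stays in the domain for a whole interval of values of \<open>\<gamma>\<close>. On each of these discs the
  Schwarz-Pick lemma applies to an extremal \<open>\<psi>\<close>. It bounds a complex affine function of \<open>\<gamma>\<close> by 1,
  with equality at the given direction, so that function is constant. The equality case
  then shows that \<open>\<psi>\<close> is the same function of \<open>x\<close> on all these discs. For fixed \<open>x\<close> they meet
  the fibre in a segment, so \<open>\<psi>\<close> depends on \<open>x\<close> only. If \<open>\<gamma> = 0\<close>, the interval lies on one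
  side of the given direction and the discs \<open>X\<^sub>1, X\<^sub>2 = \<plusminus>\<i>c + (1 + e\<^sub>j \<zeta>) / (1 - e\<^sub>j \<zeta>)\<close> supply the
  missing inequality.
\<close>

section \<open>Automorphisms of the disc and the Schwarz-Pick lemma\<close>

lemma disc_automorphismI:
  assumes "m holomorphic_on ball 0 1" "n holomorphic_on ball 0 1"
    and "\<And>z. norm z < 1 \<Longrightarrow> norm (m z) < 1" "\<And>z. norm z < 1 \<Longrightarrow> norm (n z) < 1"
    and "\<And>z. norm z < 1 \<Longrightarrow> n (m z) = z" "\<And>z. norm z < 1 \<Longrightarrow> m (n z) = z"
  shows "disc_automorphism m"
proof -
  have bij: "bij_betw m (ball 0 1) (ball 0 1)"
    by (rule bij_betw_byWitness[where f' = n]) (use assms in auto)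
  have "inv_into (ball 0 1) m z = n z" if "z \<in> ball 0 1" for z
    using that assms bij by (intro inv_into_f_eq) (auto simp: bij_betw_def)
  hence "inv_into (ball 0 1) m holomorphic_on ball 0 1"
    using assms(2) holomorphic_transform by metis
  thus ?thesis
    unfolding disc_automorphism_def using assms(1) bij by blast
qed

lemma disc_automorphism_inverse:
  assumes "disc_automorphism m"
  obtains n where "m holomorphic_on ball 0 1" "n holomorphic_on ball 0 1"
    "m ` ball 0 1 \<subseteq> ball 0 1" "n ` ball 0 1 \<subseteq> ball 0 1"
    "\<And>z. z \<in> ball 0 1 \<Longrightarrow> n (m z) = z" "\<And>z. z \<in> ball 0 1 \<Longrightarrow> m (n z) = z"
proof
  let ?D = "ball (0::complex) 1"
  have bij: "bij_betw m ?D ?D" and hol: "m holomorphic_on ?D" "inv_into ?D m holomorphic_on ?D"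
    using assms by (auto simp: disc_automorphism_def)
  show "m holomorphic_on ?D" "inv_into ?D m holomorphic_on ?D" by fact+
  show "m ` ?D \<subseteq> ?D" "inv_into ?D m ` ?D \<subseteq> ?D"
    using bij_betw_imp_surj_on[OF bij] bij_betw_imp_surj_on[OF bij_betw_inv_into[OF bij]]
    by simp_all
  show "inv_into ?D m (m z) = z" "m (inv_into ?D m z) = z" if "z \<in> ?D" for z
    using that bij by (simp_all add: bij_betw_inv_into_left bij_betw_inv_into_right)
qed

lemma disc_automorphism_compose:
  assumes "disc_automorphism f" and "disc_automorphism g"
  shows "disc_automorphism (\<lambda>z. f (g z))"
proof -
  let ?D = "ball (0::complex) 1"
  obtain f' where f: "f holomorphic_on ?D" "f' holomorphic_on ?D" "f ` ?D \<subseteq> ?D" "f' ` ?D \<subseteq> ?D"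
    "\<And>z. z \<in> ?D \<Longrightarrow> f' (f z) = z" "\<And>z. z \<in> ?D \<Longrightarrow> f (f' z) = z"
    using disc_automorphism_inverse[OF assms(1)] by metis
  obtain g' where g: "g holomorphic_on ?D" "g' holomorphic_on ?D" "g ` ?D \<subseteq> ?D" "g' ` ?D \<subseteq> ?D"
    "\<And>z. z \<in> ?D \<Longrightarrow> g' (g z) = z" "\<And>z. z \<in> ?D \<Longrightarrow> g (g' z) = z"
    using disc_automorphism_inverse[OF assms(2)] by metis
  show ?thesis
  proof (rule disc_automorphismI)
    show "(\<lambda>z. f (g z)) holomorphic_on ?D" "(\<lambda>z. g' (f' z)) holomorphic_on ?D"
      using holomorphic_on_compose_gen[OF g(1) f(1) g(3)] holomorphic_on_compose_gen[OF f(2) g(2) f(4)]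
      by (simp_all add: o_def)
    fix z :: complex assume "norm z < 1"
    hence z: "z \<in> ?D" by simp
    have "g z \<in> ?D" "f (g z) \<in> ?D" "f' z \<in> ?D" "g' (f' z) \<in> ?D"
      using f(3,4) g(3,4) z by blast+
    with z f(5,6) g(5,6) show "norm (f (g z)) < 1" "norm (g' (f' z)) < 1"
      "g' (f' (f (g z))) = z" "f (g (g' (f' z))) = z"
      by simp_all
  qed
qed

lemma disc_automorphism_rotation:
  assumes "norm c = 1"
  shows "disc_automorphism (\<lambda>z. c * z)"
  by (rule disc_automorphismI[where n = "\<lambda>z. z / c"])
     (use assms in \<open>auto intro!: holomorphic_intros simp: norm_mult norm_divide\<close>)

lemma disc_automorphism_Moebius:
  assumes "norm w < 1"
  shows "disc_automorphism (Moebius_function 0 w)"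
  by (rule disc_automorphismI[where n = "Moebius_function 0 (- w)"])
     (use assms in \<open>auto intro: Moebius_function_holomorphic Moebius_function_norm_lt_1
        Moebius_function_compose\<close>)

text \<open>Composing \<open>f\<close> with the Moebius map that sends \<open>w\<close> to 0 gives a
  self-map of the disc fixing 0 with derivative \<open>c\<close> there, because that Moebius map has
  derivative \<open>1 / (1 - |w|^2)\<close> at \<open>w\<close>. The Schwarz lemma bounds
  \<open>c\<close>; if \<open>|c| = 1\<close>, the composite is a rotation, and undoing the Moebius
  map gives the formula.\<close>

lemma schwarz_pick_at_0:
  assumes hol: "f holomorphic_on ball 0 1" and f: "\<And>z. norm z < 1 \<Longrightarrow> norm (f z) < 1"
    and df: "(f has_field_derivative d) (at 0)"
  defines "w \<equiv> f 0"
  defines "c \<equiv> d / of_real (1 - (norm w)\<^sup>2)"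
  shows "norm c \<le> 1"
    and "norm c = 1 \<Longrightarrow> norm z < 1 \<Longrightarrow> f z = Moebius_function 0 (- w) (c * z)"
proof -
  define g where "g = (\<lambda>z. Moebius_function 0 w (f z))"
  have w: "norm w < 1" using f[of 0] by (simp add: w_def)
  have ww: "1 - cnj w * w = of_real (1 - (norm w)\<^sup>2)"
    using complex_norm_square[of w] by (simp add: mult.commute)
  have "(norm w)\<^sup>2 < 1" using w by (simp add: abs_square_less_1)
  hence w1: "1 - (norm w)\<^sup>2 \<noteq> 0" by linarith
  have nz: "1 - cnj w * w \<noteq> 0" unfolding ww using w1 by (simp only: of_real_eq_0_iff not_False_eq_True)
  have holg: "g holomorphic_on ball 0 1"
    unfolding g_def
    by (rule holomorphic_on_compose_gen[unfolded o_def, OF hol Moebius_function_holomorphic[OF w]])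
       (use f in auto)
  have g0: "g 0 = 0" by (simp add: g_def w_def Moebius_function_eq_zero)
  have g1: "norm (g z) < 1" if "norm z < 1" for z
    using that f w by (simp add: g_def Moebius_function_norm_lt_1)
  have "(Moebius_function 0 w has_field_derivative 1 / (1 - cnj w * w)) (at (f 0))"
  proof -
    have "((\<lambda>z. (z - w) / (1 - cnj w * z)) has_field_derivative
        (1 * (1 - cnj w * w) - (w - w) * (0 - cnj w * 1)) / ((1 - cnj w * w) * (1 - cnj w * w))) (at w)"
      by (intro DERIV_divide) (use nz in \<open>auto intro!: derivative_eq_intros\<close>)
    thus ?thesis
      using nz by (simp add: w_def[symmetric] Moebius_function_simple[abs_def])
  qed
  from DERIV_chain2[OF this df] have "(g has_field_derivative c) (at 0)"
    unfolding g_def c_def ww by simp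
  hence dg: "deriv g 0 = c" by (rule DERIV_imp_deriv)
  show "norm c \<le> 1" using Schwarz_Lemma(2)[OF holg g0 g1, of 0] dg by simp
  show "f z = Moebius_function 0 (- w) (c * z)" if c1: "norm c = 1" and z: "norm z < 1"
  proof -
    obtain \<alpha> where al: "\<And>z. norm z < 1 \<Longrightarrow> g z = \<alpha> * z"
      using Schwarz_Lemma(3)[OF holg g0 g1, of 0] c1 dg by auto
    \<comment> \<open>The Schwarz lemma only provides some factor \<alpha>; comparing derivatives at
      0 identifies it with \<open>c\<close>.\<close>
    have "(g has_field_derivative \<alpha>) (at 0)"
    proof (rule has_field_derivative_transform_within_open)
      show "((\<lambda>z. \<alpha> * z) has_field_derivative \<alpha>) (at 0)"
        by (auto intro!: derivative_eq_intros)
      show "open (ball (0::complex) 1)" by simp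
    qed (use al in auto)
    from DERIV_imp_deriv[OF this] have "\<alpha> = c" using dg by simp
    hence "Moebius_function 0 w (f z) = c * z" using al[OF z] by (simp add: g_def)
    thus ?thesis using Moebius_function_compose[of "-w" w "f z"] w f[OF z] by simp
  qed
qed

section \<open>Complex differentiability in two variables\<close>

definition complex_diff :: "(complex \<times> complex \<Rightarrow> complex) \<Rightarrow> complex \<times> complex \<Rightarrow> bool" where
  "complex_diff F p \<longleftrightarrow> (\<exists>a b. (F has_derivative (\<lambda>h. a * fst h + b * snd h)) (at p))"

lemma holomorphic2_on_iff: "F holomorphic2_on S \<longleftrightarrow> (\<forall>p\<in>S. complex_diff F p)"
  by (simp add: holomorphic2_on_def complex_diff_def)

lemma complex_diff_intros:
  assumes "complex_diff f p" "complex_diff g p"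
  shows "complex_diff (\<lambda>p. f p + g p) p"
    and "complex_diff (\<lambda>p. f p - g p) p"
    and "complex_diff (\<lambda>p. f p * g p) p"
    and "g p \<noteq> 0 \<Longrightarrow> complex_diff (\<lambda>p. f p / g p) p"
proof -
  obtain a b a' b' where
    d: "(f has_derivative (\<lambda>h. a * fst h + b * snd h)) (at p)"
       "(g has_derivative (\<lambda>h. a' * fst h + b' * snd h)) (at p)"
    using assms unfolding complex_diff_def by blast
  show "complex_diff (\<lambda>p. f p + g p) p"
    unfolding complex_diff_def
    by (rule exI[of _ "a + a'"], rule exI[of _ "b + b'"],
        rule has_derivative_eq_rhs[OF has_derivative_add[OF d]])
       (simp add: fun_eq_iff algebra_simps)
  show "complex_diff (\<lambda>p. f p - g p) p"
    unfolding complex_diff_def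
    by (rule exI[of _ "a - a'"], rule exI[of _ "b - b'"],
        rule has_derivative_eq_rhs[OF has_derivative_diff[OF d]])
       (simp add: fun_eq_iff algebra_simps)
  show "complex_diff (\<lambda>p. f p * g p) p"
    unfolding complex_diff_def
    by (rule exI[of _ "f p * a' + a * g p"], rule exI[of _ "f p * b' + b * g p"],
        rule has_derivative_eq_rhs[OF has_derivative_mult[OF d]])
       (simp add: fun_eq_iff algebra_simps)
  show "complex_diff (\<lambda>p. f p / g p) p" if "g p \<noteq> 0"
    unfolding complex_diff_def
    by (rule exI[of _ "(a * g p - f p * a') / (g p * g p)"],
        rule exI[of _ "(b * g p - f p * b') / (g p * g p)"],
        rule has_derivative_eq_rhs[OF has_derivative_divide'[OF d that]])
       (simp add: fun_eq_iff add_divide_distrib diff_divide_distrib algebra_simps)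
qed

lemma complex_diff_const: "complex_diff (\<lambda>p. c) p"
  unfolding complex_diff_def by (rule exI[of _ 0])+ simp

lemma complex_diff_fst: "complex_diff fst p"
  unfolding complex_diff_def
  by (rule exI[of _ 1], rule exI[of _ 0]) (auto intro!: derivative_eq_intros)

lemma complex_diff_snd: "complex_diff snd p"
  unfolding complex_diff_def
  by (rule exI[of _ 0], rule exI[of _ 1]) (auto intro!: derivative_eq_intros)

lemma complex_diff_power:
  assumes "complex_diff f p"
  shows "complex_diff (\<lambda>p. f p ^ n) p"
  by (induction n) (auto intro!: complex_diff_intros complex_diff_const assms)

lemmas complex_diff_rules =
  complex_diff_intros complex_diff_const complex_diff_fst complex_diff_snd complex_diff_power

lemma has_field_derivative_along_curve:
  assumes F: "(F has_derivative (\<lambda>h. a * fst h + b * snd h)) (at (f z, g z))"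
    and f: "(f has_field_derivative f') (at z)" and g: "(g has_field_derivative g') (at z)"
  shows "((\<lambda>z. F (f z, g z)) has_field_derivative a * f' + b * g') (at z)"
proof -
  have "((\<lambda>z. (f z, g z)) has_derivative (\<lambda>h. (f' * h, g' * h))) (at z)"
    using f g by (intro has_derivative_Pair) (simp_all add: has_field_derivative_def)
  from has_derivative_compose[OF this F] show ?thesis
    unfolding has_field_derivative_def
    by (rule has_derivative_eq_rhs) (auto simp: fun_eq_iff algebra_simps)
qed

lemma directional_deriv_eq:
  assumes "(F has_derivative (\<lambda>h. a * fst h + b * snd h)) (at p)"
  shows "directional_deriv v F p = a * fst v + b * snd v"
proof -
  have F: "(F has_derivative (\<lambda>h. a * fst h + b * snd h)) (at (fst p, snd p))"
    using assms by simp
  have "((\<lambda>s. F (s, snd p)) has_field_derivative a * 1 + b * 0) (at (fst p))"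
    by (rule has_field_derivative_along_curve[where f = "\<lambda>s. s" and g = "\<lambda>s. snd p", OF F])
       (auto intro!: derivative_eq_intros)
  moreover have "((\<lambda>s. F (fst p, s)) has_field_derivative a * 0 + b * 1) (at (snd p))"
    by (rule has_field_derivative_along_curve[where f = "\<lambda>s. fst p" and g = "\<lambda>s. s", OF F])
       (auto intro!: derivative_eq_intros)
  ultimately show ?thesis
    unfolding directional_deriv_def by (simp add: DERIV_imp_deriv)
qed

text \<open>One pair \<open>a\<close>, \<open>b\<close> serves every direction \<open>v\<close>, so
  this yields both the differentiability of the composite and the chain rule for directional
  derivatives.\<close>

lemma has_derivative_compose2:
  assumes F: "(F has_derivative (\<lambda>h. A * fst h + B * snd h)) (at (f p, g p))"
    and f: "complex_diff f p" and g: "complex_diff g p"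
  shows "\<exists>a b. ((\<lambda>p. F (f p, g p)) has_derivative (\<lambda>h. a * fst h + b * snd h)) (at p) \<and>
      (\<forall>v. a * fst v + b * snd v = A * directional_deriv v f p + B * directional_deriv v g p)"
proof -
  obtain a b a' b' where
    d: "(f has_derivative (\<lambda>h. a * fst h + b * snd h)) (at p)"
       "(g has_derivative (\<lambda>h. a' * fst h + b' * snd h)) (at p)"
    using f g unfolding complex_diff_def by blast
  have "((\<lambda>p. F (f p, g p)) has_derivative
      (\<lambda>h. A * (a * fst h + b * snd h) + B * (a' * fst h + b' * snd h))) (at p)"
    using has_derivative_compose[OF has_derivative_Pair[OF d] F] by simp
  moreover have "(\<lambda>h. A * (a * fst h + b * snd h) + B * (a' * fst h + b' * snd h)) =
      (\<lambda>h. (A * a + B * a') * fst h + (A * b + B * b') * snd h)"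
    by (simp add: fun_eq_iff algebra_simps)
  ultimately show ?thesis
    by (intro exI[of _ "A * a + B * a'"] exI[of _ "A * b + B * b'"])
       (simp add: directional_deriv_eq[OF d(1)] directional_deriv_eq[OF d(2)] algebra_simps)
qed

lemma complex_diff_compose2:
  assumes "complex_diff F (f p, g p)" "complex_diff f p" "complex_diff g p"
  shows "complex_diff (\<lambda>p. F (f p, g p)) p"
proof -
  obtain A B where "(F has_derivative (\<lambda>h. A * fst h + B * snd h)) (at (f p, g p))"
    using assms(1) unfolding complex_diff_def by blast
  from has_derivative_compose2[OF this assms(2,3)] show ?thesis
    unfolding complex_diff_def by blast
qed

text \<open>The one-variable lemma applied to \<open>F\<close> along an analytic disc in
  \<open>S\<close>. Here \<open>c\<close> is the derivative of \<open>F\<close> along the tangent of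
  the disc, normalized as in the Caratheodory quotient.\<close>

lemma schwarz_pick_disc:
  assumes F: "F \<in> disc_maps S"
    and dF: "(F has_derivative (\<lambda>h. a * fst h + b * snd h)) (at (X 0, Y 0))"
    and hol: "X holomorphic_on ball 0 1" "Y holomorphic_on ball 0 1"
    and S: "\<And>z. norm z < 1 \<Longrightarrow> (X z, Y z) \<in> S"
    and d: "(X has_field_derivative X') (at 0)" "(Y has_field_derivative Y') (at 0)"
  defines "w \<equiv> F (X 0, Y 0)"
  defines "c \<equiv> (a * X' + b * Y') / of_real (1 - (norm w)\<^sup>2)"
  shows "norm c \<le> 1"
    and "norm c = 1 \<Longrightarrow> norm z < 1 \<Longrightarrow> F (X z, Y z) = Moebius_function 0 (- w) (c * z)"
proof -
  have "(\<lambda>z. F (X z, Y z)) field_differentiable (at z)" if z: "z \<in> ball 0 1" for z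
  proof -
    have "(X z, Y z) \<in> S" using S z by simp
    then obtain a b where 1: "(F has_derivative (\<lambda>h. a * fst h + b * snd h)) (at (X z, Y z))"
      using F unfolding disc_maps_def holomorphic2_on_def by blast
    obtain X' Y' where 2: "(X has_field_derivative X') (at z)" "(Y has_field_derivative Y') (at z)"
      using hol[THEN holomorphic_on_imp_differentiable_at, of z] z
      unfolding field_differentiable_def by auto
    show ?thesis
      using has_field_derivative_along_curve[OF 1 2] field_differentiable_def by blast
  qed
  hence holF: "(\<lambda>z. F (X z, Y z)) holomorphic_on ball 0 1"
    by (simp add: holomorphic_on_def field_differentiable_at_within)
  have F1: "norm (F (X z, Y z)) < 1" if "norm z < 1" for z
    using S[OF that] F unfolding disc_maps_def by auto
  note dFX = has_field_derivative_along_curve[OF dF d]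
  show "norm c \<le> 1"
    using schwarz_pick_at_0(1)[OF holF F1 dFX] by (simp add: c_def w_def)
  show "norm c = 1 \<Longrightarrow> norm z < 1 \<Longrightarrow> F (X z, Y z) = Moebius_function 0 (- w) (c * z)"
    using schwarz_pick_at_0(2)[OF holF F1 dFX, of z] by (simp add: c_def w_def)
qed

section \<open>The symmetrized half-plane\<close>

text \<open>This is the image of the pairs \<open>X1\<close>, \<open>X2\<close> in the right
  half-plane under \<open>x = (X1 + X2) / 2\<close>, \<open>q = ((X1 - X2) / 2)^2\<close>, described
  without choosing a square root of \<open>q\<close>.\<close>

definition sym_half_plane :: "(complex \<times> complex) set" where
  "sym_half_plane = {(x, q). 0 < Re x \<and> (Im q)\<^sup>2 < 4 * (Re x)\<^sup>2 * ((Re x)\<^sup>2 - Re q)}"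

text \<open>The right-hand side says that \<open>x + d\<close> and \<open>x - d\<close> both have
  positive real part. Expanded, the defining inequality is the positivity of
  \<open>4 (u^2 - d1^2) (u^2 + d2^2)\<close>.\<close>

lemma mem_sym_half_plane_square:
  "(x, d\<^sup>2) \<in> sym_half_plane \<longleftrightarrow> \<bar>Re d\<bar> < Re x"
proof (cases "0 < Re x")
  case True
  define u d1 d2 where "u = Re x" and "d1 = Re d" and "d2 = Im d"
  have u: "0 < u" using True by (simp add: u_def)
  have "(x, d\<^sup>2) \<in> sym_half_plane \<longleftrightarrow> (2 * d1 * d2)\<^sup>2 < 4 * u\<^sup>2 * (u\<^sup>2 - (d1\<^sup>2 - d2\<^sup>2))"
    using u by (simp add: sym_half_plane_def u_def d1_def d2_def Re_power2 Im_power2)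
  also have "\<dots> \<longleftrightarrow> 0 < 4 * ((u\<^sup>2 - d1\<^sup>2) * (u\<^sup>2 + d2\<^sup>2))"
    by (simp add: algebra_simps power2_eq_square)
  also have "\<dots> \<longleftrightarrow> d1\<^sup>2 < u\<^sup>2"
    using u by (simp add: zero_less_mult_iff add_pos_nonneg not_less add_nonneg_nonneg)
      (smt (verit) zero_le_power2)
  also have "\<dots> \<longleftrightarrow> \<bar>d1\<bar> < u"
    using u abs_le_square_iff[of u d1] by linarith
  finally show ?thesis by (simp add: u_def d1_def)
next
  case False
  thus ?thesis by (auto simp: sym_half_plane_def)
qed

lemma sym_half_plane_cases:
  assumes "(x, q) \<in> sym_half_plane"
  obtains d where "q = d\<^sup>2" "\<bar>Re d\<bar> < Re x"
proof
  show q: "q = (csqrt q)\<^sup>2" by simp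
  show "\<bar>Re (csqrt q)\<bar> < Re x"
    using assms mem_sym_half_plane_square[of x "csqrt q"] by simp
qed

text \<open>The half-plane automorphism \<open>X \<mapsto> u X + i t\<close> is applied to both
  points \<open>x + d\<close> and \<open>x - d\<close>; it scales \<open>d\<close> by
  \<open>u\<close>. These maps serve to move the base point to \<open>x = 1\<close>.\<close>

lemma sym_half_plane_affine:
  assumes "(x, q) \<in> sym_half_plane" and "0 < u"
  shows "(of_real u * x + \<i> * of_real t, of_real (u\<^sup>2) * q) \<in> sym_half_plane"
proof -
  obtain d where d: "q = d\<^sup>2" "\<bar>Re d\<bar> < Re x"
    using sym_half_plane_cases[OF assms(1)] .
  have "(of_real u * x + \<i> * of_real t, (of_real u * d)\<^sup>2) \<in> sym_half_plane"
    unfolding mem_sym_half_plane_square using d(2) assms(2) by (simp add: abs_mult)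
  thus ?thesis by (simp add: d(1) power_mult_distrib)
qed

section \<open>Cayley transforms between the disc and the right half-plane\<close>

lemma Re_cayley_pos:
  assumes "norm z < 1"
  shows "0 < Re ((1 + z) / (1 - z))"
proof -
  have "z \<noteq> 1" using assms by auto
  hence nz: "(Re (1 - z))\<^sup>2 + (Im (1 - z))\<^sup>2 > 0"
    by (metis cmod_power2 norm_eq_zero right_minus_eq zero_less_power2)
  have "(Re z)\<^sup>2 + (Im z)\<^sup>2 < 1"
    using assms cmod_power2[of z] by (metis abs_norm_cancel abs_square_less_1)
  hence "0 < (1 + Re z) * (1 - Re z) - Im z * Im z"
    by (simp add: algebra_simps power2_eq_square)
  thus ?thesis using nz by (simp add: Re_divide)
qed

lemma cayley_in_disc:
  assumes "0 < Re x"
  shows "norm ((x - 1) / (x + 1)) < 1"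
proof -
  have "x + 1 \<noteq> 0" using assms by (auto simp: complex_eq_iff)
  moreover have "(cmod (x - 1))\<^sup>2 < (cmod (x + 1))\<^sup>2"
    using assms unfolding cmod_power2 by (simp add: power2_eq_square algebra_simps)
  ultimately show ?thesis
    by (simp add: norm_divide) (meson norm_ge_zero power_less_imp_less_base)
qed

lemma has_field_derivative_cayley:
  "((\<lambda>z::complex. (1 + e * z) / (1 - e * z)) has_field_derivative 2 * e) (at 0)"
  by (auto intro!: derivative_eq_intros)

lemma holomorphic_cayley:
  assumes "norm e = 1"
  shows "(\<lambda>z. (1 + e * z) / (1 - e * z)) holomorphic_on ball 0 1"
proof (intro holomorphic_intros)
  show "1 - e * z \<noteq> 0" if "z \<in> ball 0 1" for z
  proof
    assume "1 - e * z = 0"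
    hence "norm (e * z) = 1" by (metis eq_iff_diff_eq_0 norm_one)
    thus False using that assms by (simp add: norm_mult)
  qed
qed

text \<open>With \<open>x = u + i v\<close>, dividing the defining inequality by \<open>u^2\<close>
  leaves \<open>4 (1 - \<gamma>) u^2\<close> plus a quadratic in \<open>v\<close>. Multiplied by
  \<gamma>, that quadratic is \<open>(1 - \<gamma>) (2 \<gamma> v + \<beta>)^2\<close> plus
  \<open>4 \<gamma> \<alpha> - \<beta>^2\<close>; for \<open>\<gamma> = 0\<close> the premise forces
  \<open>\<beta> = 0\<close>.\<close>

lemma parabola_disc_in_sym_half_plane:
  fixes \<alpha> \<beta> \<gamma> :: real
  assumes x: "0 < Re x" and g: "0 \<le> \<gamma>" "\<gamma> < 1" and disc: "\<beta>\<^sup>2 \<le> 4 * \<gamma> * \<alpha>" and a: "0 \<le> \<alpha>"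
  shows "(x, of_real \<gamma> * x\<^sup>2 + \<i> * of_real \<beta> * x - of_real \<alpha>) \<in> sym_half_plane"
proof -
  define u v where "u = Re x" and "v = Im x"
  have u: "0 < u" using x by (simp add: u_def)
  have *: "0 \<le> 4 * \<gamma> * (1 - \<gamma>) * v\<^sup>2 + 4 * \<beta> * (1 - \<gamma>) * v + 4 * \<alpha> - \<beta>\<^sup>2"
  proof (cases "\<gamma> = 0")
    case True
    thus ?thesis using disc a by simp
  next
    case False
    hence g0: "0 < \<gamma>" using g by simp
    have "\<gamma> * (4 * \<gamma> * (1 - \<gamma>) * v\<^sup>2 + 4 * \<beta> * (1 - \<gamma>) * v + 4 * \<alpha> - \<beta>\<^sup>2) =
        (1 - \<gamma>) * (2 * \<gamma> * v + \<beta>)\<^sup>2 + (4 * \<gamma> * \<alpha> - \<beta>\<^sup>2)"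
      by (simp add: algebra_simps power2_eq_square)
    also have "\<dots> \<ge> 0" using g disc by simp
    finally show ?thesis using g0 by (simp add: zero_le_mult_iff)
  qed
  have "0 < u\<^sup>2 * (4 * (1 - \<gamma>) * u\<^sup>2 +
      (4 * \<gamma> * (1 - \<gamma>) * v\<^sup>2 + 4 * \<beta> * (1 - \<gamma>) * v + 4 * \<alpha> - \<beta>\<^sup>2))"
    using u g * by (intro mult_pos_pos add_pos_nonneg) auto
  also have "\<dots> = 4 * u\<^sup>2 * (u\<^sup>2 - (\<gamma> * (u\<^sup>2 - v\<^sup>2) - \<beta> * v - \<alpha>)) - (\<gamma> * (2 * u * v) + \<beta> * u)\<^sup>2"
    by (simp add: algebra_simps power2_eq_square)
  finally show ?thesis
    using u by (simp add: sym_half_plane_def u_def v_def Re_power2 Im_power2)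
qed

section \<open>Positivity of real cubics and quadratics\<close>

lemma cubic_pos_imp_leading_zero:
  fixes a b c d :: real
  assumes "\<And>t. 0 < a * t ^ 3 + b * t\<^sup>2 + c * t + d"
  shows "a = 0"
proof (rule ccontr)
  assume a: "a \<noteq> 0"
  \<comment> \<open>The choice gives \<open>1 \<le> M\<close> and
    \<open>|a| M = |a| + |b| + |c| + |d|\<close>. At the point \<open>t\<close> of modulus
    \<open>M\<close> and sign opposite to \<open>a\<close>, the negative cubic term then outweighs
    the rest.\<close>
  define M where "M = 1 + (\<bar>b\<bar> + \<bar>c\<bar> + \<bar>d\<bar>) / \<bar>a\<bar>"
  have M: "1 \<le> M" by (simp add: M_def)
  have aM: "\<bar>a\<bar> * M = \<bar>a\<bar> + \<bar>b\<bar> + \<bar>c\<bar> + \<bar>d\<bar>" using a by (simp add: M_def field_simps)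
  define t where "t = - sgn a * M"
  have at: "a * t = - \<bar>a\<bar> * M" by (simp add: t_def abs_sgn)
  have t2: "t\<^sup>2 = M\<^sup>2" using a by (simp add: t_def power_mult_distrib sgn_if)
  have "\<bar>t\<bar> = M" using a M by (simp add: t_def abs_mult)
  have "M \<le> M\<^sup>2" "1 \<le> M\<^sup>2" using M by (simp_all add: self_le_power one_le_power)
  have "a * t ^ 3 = a * t * t\<^sup>2" by (simp add: power3_eq_cube power2_eq_square)
  also have "\<dots> = - (\<bar>a\<bar> * M) * M\<^sup>2" by (simp add: at t2)
  also have "\<dots> = - \<bar>a\<bar> * M\<^sup>2 - \<bar>b\<bar> * M\<^sup>2 - \<bar>c\<bar> * M\<^sup>2 - \<bar>d\<bar> * M\<^sup>2"
    unfolding aM by (simp add: algebra_simps)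
  finally have 1: "a * t ^ 3 = \<dots>" .
  have 2: "b * t\<^sup>2 \<le> \<bar>b\<bar> * M\<^sup>2" by (simp add: t2 mult_right_mono)
  have "c * t \<le> \<bar>c\<bar> * \<bar>t\<bar>" by (metis abs_ge_self abs_mult)
  also have "\<dots> \<le> \<bar>c\<bar> * M\<^sup>2" using \<open>M \<le> M\<^sup>2\<close> \<open>\<bar>t\<bar> = M\<close> by (simp add: mult_left_mono)
  finally have 3: "c * t \<le> \<bar>c\<bar> * M\<^sup>2" .
  have "\<bar>d\<bar> * 1 \<le> \<bar>d\<bar> * M\<^sup>2" using \<open>1 \<le> M\<^sup>2\<close> by (intro mult_left_mono) auto
  hence 4: "d \<le> \<bar>d\<bar> * M\<^sup>2" by linarith
  have "0 \<le> \<bar>a\<bar> * M\<^sup>2" by simp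
  with 1 2 3 4 assms[of t] show False by linarith
qed

lemma quadratic_pos:
  fixes a b c :: real
  assumes pos: "\<And>t. 0 < a * t\<^sup>2 + b * t + c"
  shows "0 \<le> a" and "0 < c" and "a = 0 \<Longrightarrow> b = 0" and "a \<noteq> 0 \<Longrightarrow> b\<^sup>2 < 4 * a * c"
proof -
  show c: "0 < c" using pos[of 0] by simp
  show "a = 0 \<Longrightarrow> b = 0" using pos[of "- c / b"] by (cases "b = 0") auto
  have vertex: "0 < c - b\<^sup>2 / (4 * a)" if "a \<noteq> 0"
  proof -
    have "a * (- b / (2 * a))\<^sup>2 + b * (- b / (2 * a)) + c = c - b\<^sup>2 / (4 * a)"
      using that by (simp add: field_simps power2_eq_square)
    thus ?thesis using pos[of "- b / (2 * a)"] by simp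
  qed
  show a: "0 \<le> a"
  proof (rule ccontr)
    assume a: "\<not> 0 \<le> a"
    \<comment> \<open>For this \<open>t\<close> the sum \<open>a t^2 + c\<close> vanishes, so the
      values at \<open>t\<close> and \<open>- t\<close> are \<open>b t\<close> and
      \<open>- b t\<close>, which cannot both be positive.\<close>
    define t where "t = sqrt (- c / a)"
    have "t\<^sup>2 = - c / a" using a c unfolding t_def by (intro real_sqrt_pow2) (simp add: divide_nonneg_neg)
    hence "a * t\<^sup>2 = - c" using a by simp
    thus False using pos[of t] pos[of "- t"] by simp
  qed
  show "b\<^sup>2 < 4 * a * c" if "a \<noteq> 0"
    using vertex[OF that] a that by (simp add: field_simps)
qed

text \<open>
  At \<open>(1, q)\<close> and in the direction \<open>(1, dq)\<close>, the premise says that the coordinate \<open>x\<close> has a larger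
  Caratheodory quotient than \<open>(x - \<i>t) / ((x - \<i>t)\<^sup>2 - q)\<close>. The difference of the squares is a cubic
  in \<open>t\<close> whose positivity gives all the conclusions.
\<close>
lemma strict_maximum_direction:
  fixes q dq :: complex
  assumes "\<And>t::real. norm ((1 - \<i> * of_real t)\<^sup>2 + q - (1 - \<i> * of_real t) * dq) <
      (norm (1 - \<i> * of_real t))\<^sup>2 - Re ((1 - \<i> * of_real t) * cnj q)"
  shows "Im dq = Im q" and "0 \<le> Re dq" and "Re dq < 2"
    and "Re dq = 0 \<Longrightarrow> Im q = 0 \<and> Re q < 0"
    and "Re dq \<noteq> 0 \<Longrightarrow> (Im q)\<^sup>2 < Re dq * (Re dq - 2 * Re q)"
proof -
  define q1 q2 r j where "q1 = Re q" and "q2 = Im q" and "r = Re dq" and "j = Im dq"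
  have sq: "(t\<^sup>2 + t * j + (r - 1 - q1))\<^sup>2 + ((r - 2) * t + q2 - j)\<^sup>2 < (t\<^sup>2 + t * q2 + (1 - q1))\<^sup>2"
    for t
  proof -
    define L where "L = (1 - \<i> * of_real t)\<^sup>2 + q - (1 - \<i> * of_real t) * dq"
    define R where "R = (norm (1 - \<i> * of_real t))\<^sup>2 - Re ((1 - \<i> * of_real t) * cnj q)"
    have "norm L < R" using assms[of t] unfolding L_def R_def .
    hence "(norm L)\<^sup>2 < R\<^sup>2" by (intro power_strict_mono) auto
    moreover have "Re L = - (t\<^sup>2 + t * j + (r - 1 - q1))" "Im L = (r - 2) * t + q2 - j"
      by (simp_all add: L_def q1_def q2_def r_def j_def Re_power2 Im_power2 algebra_simps)
    moreover have "R = t\<^sup>2 + t * q2 + (1 - q1)"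
      unfolding R_def cmod_power2 by (simp add: q1_def q2_def algebra_simps)
    ultimately show ?thesis unfolding cmod_power2 by (metis power2_minus)
  qed
  \<comment> \<open>The fourth powers of \<open>t\<close> cancel in the difference of the squares,
    leaving a cubic with this leading coefficient.\<close>
  have "2 * (q2 - j) = 0"
  proof (rule cubic_pos_imp_leading_zero)
    fix t
    show "0 < 2 * (q2 - j) * t ^ 3 + (q2\<^sup>2 + 2 * (1 - q1) - j\<^sup>2 - 2 * (r - 1 - q1) - (r - 2)\<^sup>2) * t\<^sup>2
        + (2 * q2 * (1 - q1) - 2 * j * (r - 1 - q1) - 2 * (r - 2) * (q2 - j)) * t
        + ((1 - q1)\<^sup>2 - (r - 1 - q1)\<^sup>2 - (q2 - j)\<^sup>2)"
      using sq[of t] by (simp add: algebra_simps power2_eq_square power3_eq_cube)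
  qed
  hence j: "j = q2" by simp
  thus "Im dq = Im q" by (simp add: j_def q2_def)
  \<comment> \<open>Once \<open>j = q2\<close>, the difference of the squares is
    \<open>2 - r\<close> times \<open>r t^2 + 2 q2 t + (r - 2 q1)\<close>. The constant term
    excludes \<open>r = 2\<close>, the leading coefficient confines \<open>r\<close> to
    \<open>[0, 2)\<close>, and for \<open>r \<noteq> 0\<close> the discriminant gives the last
    claim.\<close>
  have fac: "0 < (2 - r) * r * t\<^sup>2 + 2 * (2 - r) * q2 * t + (2 - r) * (r - 2 * q1)" for t
    using sq[of t] unfolding j by (simp add: algebra_simps power2_eq_square)
  note Q = quadratic_pos[OF fac]
  have "r \<noteq> 2" using Q(2) by auto
  moreover have "\<not> (2 < r)" using Q(1) by (auto simp: zero_le_mult_iff)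
  ultimately have r2: "r < 2" by simp
  thus "Re dq < 2" by (simp add: r_def)
  show r0: "0 \<le> Re dq" using Q(1) r2 by (auto simp: zero_le_mult_iff r_def)
  show "Im q = 0 \<and> Re q < 0" if "Re dq = 0"
    using Q(2,3) r2 that by (auto simp: r_def q1_def q2_def zero_less_mult_iff)
  show "(Im q)\<^sup>2 < Re dq * (Re dq - 2 * Re q)" if "Re dq \<noteq> 0"
  proof -
    have "(2 * (2 - r) * q2)\<^sup>2 < 4 * ((2 - r) * r) * ((2 - r) * (r - 2 * q1))"
      using Q(4) that r2 by (simp add: r_def)
    hence "4 * (2 - r)\<^sup>2 * q2\<^sup>2 < 4 * (2 - r)\<^sup>2 * (r * (r - 2 * q1))"
      by (simp add: algebra_simps power2_eq_square)
    moreover have "0 < 4 * (2 - r)\<^sup>2" using r2 by simp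
    ultimately show ?thesis by (simp only: mult_less_cancel_left_pos q1_def q2_def r_def)
  qed
qed

text \<open>Points of the unit circle are extreme in the closed disc: the parallelogram identity is
  applied to \<open>C + t B\<close> and \<open>C - t B\<close>.\<close>

lemma eq_0_if_norm_add_le_on_interval:
  fixes B C :: complex
  assumes "norm C = 1" "0 < e" "\<And>t. \<bar>t\<bar> < e \<Longrightarrow> norm (C + of_real t * B) \<le> 1"
  shows "B = 0"
proof -
  define t where "t = e / 2"
  have "norm (C + of_real t * B) \<le> 1" "norm (C - of_real t * B) \<le> 1"
    using assms(3)[of t] assms(3)[of "- t"] assms(2) by (auto simp: t_def)
  hence "(norm (C + of_real t * B))\<^sup>2 + (norm (C - of_real t * B))\<^sup>2 \<le> 1 + 1"
    by (intro add_mono) (simp_all add: power_le_one)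
  also have "(norm (C + of_real t * B))\<^sup>2 + (norm (C - of_real t * B))\<^sup>2 =
      2 * (norm C)\<^sup>2 + 2 * (norm (of_real t * B))\<^sup>2"
    unfolding cmod_power2 by (simp add: power2_eq_square algebra_simps)
  finally have "(norm (of_real t * B))\<^sup>2 \<le> 0" using assms(1) by simp
  hence "of_real t * B = 0" by simp
  thus ?thesis using assms(2) by (simp add: t_def)
qed

text \<open>This replaces the previous lemma when \<open>A + t B\<close> is controlled on one side
  only. After division by \<open>A\<close>, the two summands in the first bound add up to 1, so
  equality in the triangle inequality makes them real and \<open>E = B / A\<close> purely imaginary;
  then \<open>|1 + E| \<le> 1\<close> forces \<open>E = 0\<close>.\<close>

lemma eq_0_if_norm_sum_le:
  fixes A B :: complex
  assumes A: "norm A = 1" and c: "0 < (c::real)"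
    and 1: "norm (A / 2 + \<i> * of_real c * B) + norm (A / 2 - \<i> * of_real c * B) \<le> 1"
    and 2: "norm (A + B) \<le> 1"
  shows "B = 0"
proof -
  define E where "E = B / A"
  have A0: "A \<noteq> 0" using A by auto
  have B: "B = A * E" using A0 by (simp add: E_def)
  have "A / 2 + \<i> * of_real c * B = A * (1 / 2 + \<i> * of_real c * E)"
    "A / 2 - \<i> * of_real c * B = A * (1 / 2 - \<i> * of_real c * E)" "A + B = A * (1 + E)"
    by (simp_all add: B algebra_simps)
  with 1 2 A have 1: "norm (1 / 2 + \<i> * of_real c * E) + norm (1 / 2 - \<i> * of_real c * E) \<le> 1"
    and 2: "norm (1 + E) \<le> 1"
    by (simp_all add: norm_mult)
  have 3: "(norm (1 / 2 + \<i> * of_real c * E))\<^sup>2 = (1 / 2 - c * Im E)\<^sup>2 + (c * Re E)\<^sup>2"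
    "(norm (1 / 2 - \<i> * of_real c * E))\<^sup>2 = (1 / 2 + c * Im E)\<^sup>2 + (c * Re E)\<^sup>2"
    unfolding cmod_power2 by (simp_all add: algebra_simps)
  have "Re E = 0"
  proof (rule ccontr)
    assume "Re E \<noteq> 0"
    hence "(c * Re E)\<^sup>2 > 0" using c by simp
    hence "(1 / 2 - c * Im E)\<^sup>2 < (norm (1 / 2 + \<i> * of_real c * E))\<^sup>2"
      "(1 / 2 + c * Im E)\<^sup>2 < (norm (1 / 2 - \<i> * of_real c * E))\<^sup>2"
      by (simp_all add: 3)
    hence "1 / 2 - c * Im E < norm (1 / 2 + \<i> * of_real c * E)"
      "1 / 2 + c * Im E < norm (1 / 2 - \<i> * of_real c * E)"
      by (meson norm_ge_zero power2_less_imp_less)+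
    thus False using 1 by linarith
  qed
  moreover have "(norm (1 + E))\<^sup>2 \<le> 1" using 2 by (simp add: power_le_one)
  hence "(1 + Re E)\<^sup>2 + (Im E)\<^sup>2 \<le> 1" unfolding cmod_power2 by simp
  ultimately have "E = 0" by (simp add: complex_eq_iff)
  thus ?thesis by (simp add: B)
qed

section \<open>Extremal functions on the symmetrized half-plane\<close>

lemma open_sym_half_plane_snd: "open {q. (x, q) \<in> sym_half_plane}"
  unfolding sym_half_plane_def mem_Collect_eq case_prod_conv
  by (intro open_Collect_conj open_Collect_less continuous_intros)

lemma open_sym_half_plane_fst: "open {x. (x, q) \<in> sym_half_plane}"
  unfolding sym_half_plane_def mem_Collect_eq case_prod_conv
  by (intro open_Collect_conj open_Collect_less continuous_intros)

text \<open>The fibre is the image of a vertical strip under squaring. Connectedness is needed for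
  the identity theorem.\<close>

lemma connected_sym_half_plane_snd: "connected {q. (x, q) \<in> sym_half_plane}"
proof -
  have "{q. (x, q) \<in> sym_half_plane} = (\<lambda>d. d\<^sup>2) ` ({d. Re d < Re x} \<inter> {d. Re d > - Re x})"
  proof (intro equalityI subsetI)
    fix q assume "q \<in> {q. (x, q) \<in> sym_half_plane}"
    then obtain d where "q = d\<^sup>2" "\<bar>Re d\<bar> < Re x"
      using sym_half_plane_cases by blast
    thus "q \<in> (\<lambda>d. d\<^sup>2) ` ({d. Re d < Re x} \<inter> {d. Re d > - Re x})" by auto
  qed (auto simp: mem_sym_half_plane_square)
  moreover have "convex ({d. Re d < Re x} \<inter> {d. Re d > - Re x})"
    by (intro convex_Int convex_halfspace_Re_lt convex_halfspace_Re_gt)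
  ultimately show ?thesis
    using connected_continuous_image[OF continuous_on_power[OF continuous_on_id] convex_connected]
    by simp
qed

lemma complex_diff_imp_partial:
  assumes "complex_diff F (x, q)"
  shows "(\<lambda>q. F (x, q)) field_differentiable at q" "(\<lambda>x. F (x, q)) field_differentiable at x"
proof -
  obtain a b where d: "(F has_derivative (\<lambda>h. a * fst h + b * snd h)) (at (x, q))"
    using assms unfolding complex_diff_def by blast
  show "(\<lambda>q. F (x, q)) field_differentiable at q"
    using has_field_derivative_along_curve[of F a b "\<lambda>_. x" q "\<lambda>q. q" 0 1, OF d]
    unfolding field_differentiable_def by auto
  show "(\<lambda>x. F (x, q)) field_differentiable at x"
    using has_field_derivative_along_curve[of F a b "\<lambda>x. x" x "\<lambda>_. q" 1 0, OF d]
    unfolding field_differentiable_def by auto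
qed

text \<open>The identity theorem on the fibre over \<open>x\<close>: the points of the segment
  accumulate at its endpoint \<open>p\<close>, which lies in the fibre.\<close>

lemma constant_on_fibre:
  assumes F: "F holomorphic2_on sym_half_plane" and D: "D \<noteq> 0" and e: "0 < e"
    and seg: "\<And>t. 0 \<le> t \<Longrightarrow> t < e \<Longrightarrow>
      (x, p + of_real t * D) \<in> sym_half_plane \<and> F (x, p + of_real t * D) = k"
    and q: "(x, q) \<in> sym_half_plane"
  shows "F (x, q) = k"
proof -
  let ?S = "{q. (x, q) \<in> sym_half_plane}"
  let ?U = "(\<lambda>t. p + of_real t * D) ` {0<..<e}"
  have "F (x, q) - k = 0"
  proof (rule analytic_continuation[of "\<lambda>q. F (x, q) - k" ?S ?U p])
    have "(\<lambda>q. F (x, q)) holomorphic_on ?S"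
      using F complex_diff_imp_partial(1) unfolding holomorphic2_on_iff holomorphic_on_def
      by (auto intro: field_differentiable_at_within)
    thus "(\<lambda>q. F (x, q) - k) holomorphic_on ?S" by (intro holomorphic_intros)
    show "p islimpt ?U"
      unfolding islimpt_approachable
    proof (intro allI impI)
      fix \<epsilon> :: real assume \<epsilon>: "0 < \<epsilon>"
      define t where "t = min (e / 2) (\<epsilon> / (2 * norm D))"
      have t: "0 < t" "t < e" using e \<epsilon> D by (auto simp: t_def)
      have "t * norm D \<le> \<epsilon> / (2 * norm D) * norm D"
        by (intro mult_right_mono) (auto simp: t_def)
      also have "\<dots> < \<epsilon>" using D \<epsilon> by simp
      finally have "dist (p + of_real t * D) p < \<epsilon>" using t by (simp add: dist_norm norm_mult)
      thus "\<exists>q\<in>?U. q \<noteq> p \<and> dist q p < \<epsilon>" using t D by (intro bexI[of _ "p + of_real t * D"]) auto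
    qed
    show "?U \<subseteq> ?S" using seg by auto
    show "p \<in> ?S" using seg[of 0] e by simp
    show "\<And>z. z \<in> ?U \<Longrightarrow> F (x, z) - k = 0" using seg by auto
  qed (use q in \<open>auto intro: open_sym_half_plane_snd connected_sym_half_plane_snd\<close>)
  thus ?thesis by simp
qed

lemma cayley_inverse:
  fixes x :: complex
  assumes "x + 1 \<noteq> 0"
  shows "(1 + (x - 1) / (x + 1)) / (1 - (x - 1) / (x + 1)) = x"
proof -
  have "1 + (x - 1) / (x + 1) = 2 * x / (x + 1)" "1 - (x - 1) / (x + 1) = 2 / (x + 1)"
    using assms by (simp_all add: field_simps)
  thus ?thesis using assms by simp
qed

text \<open>By \<open>ext\<close>, \<open>F\<close> has at \<open>(1, q)\<close> in the direction
  \<open>(1, dq)\<close> the same quotient 1/2 as \<open>(x - 1) / (x + 1)\<close>. By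
  \<open>strict\<close>, this direction is tangent to one of the parabola discs.\<close>

lemma extremal_depends_on_fst:
  assumes F: "F \<in> disc_maps sym_half_plane" and q: "(1, q) \<in> sym_half_plane"
    and dF: "(F has_derivative (\<lambda>h. a * fst h + b * snd h)) (at (1, q))"
    and ext: "2 * norm (a + b * dq) = 1 - (norm (F (1, q)))\<^sup>2"
    and strict: "\<And>t::real. norm ((1 - \<i> * of_real t)\<^sup>2 + q - (1 - \<i> * of_real t) * dq) <
      (norm (1 - \<i> * of_real t))\<^sup>2 - Re ((1 - \<i> * of_real t) * cnj q)"
  shows "\<exists>c w. norm c = 1 \<and> norm w < 1 \<and>
    (\<forall>(x, p) \<in> sym_half_plane. F (x, p) = Moebius_function 0 w (c * ((x - 1) / (x + 1))))"
proof -
  note dir = strict_maximum_direction[OF strict]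
  define w where "w = F (1, q)"
  define N where "N = 1 - (norm w)\<^sup>2"
  have w1: "norm w < 1" using F q by (auto simp: disc_maps_def w_def)
  hence N: "0 < N" by (simp add: N_def abs_square_less_1)
  \<comment> \<open>For a disc with tangent \<open>2 (1, e)\<close> at 0 the Schwarz-Pick constant
    of \<open>F\<close> is \<open>A + B * e\<close>; the factor 2 is the derivative of the Cayley
    transform at 0.\<close>
  define A B where "A = 2 * a / of_real N" and "B = 2 * b / of_real N"
  define r C where "r = Re dq" and "C = A + B * dq"
  have dq: "dq = of_real r + \<i> * of_real (Im q)"
    using dir(1) by (simp add: complex_eq_iff r_def)
  have "norm (2 * (a + b * dq)) = N"
    using ext by (simp add: N_def w_def norm_mult del: distrib_left_numeral)
  moreover have "C = 2 * (a + b * dq) / of_real N"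
    by (simp add: C_def A_def B_def add_divide_distrib algebra_simps)
  ultimately have C1: "norm C = 1" using N by (simp add: norm_divide del: distrib_left_numeral)
  define X :: "complex \<Rightarrow> complex" where "X = (\<lambda>z. (1 + z) / (1 - z))"
  \<comment> \<open>Taking \<open>\<alpha> = \<gamma> - Re q\<close> makes every disc start at
    \<open>q\<close>. The tangent is \<open>2 (1, 2 \<gamma> + i Im q)\<close>, so
    \<open>\<gamma> = r / 2\<close> gives the direction \<open>(1, dq)\<close>.\<close>
  define Y where "Y = (\<lambda>\<gamma> z. of_real \<gamma> * (X z)\<^sup>2 + \<i> * of_real (Im q) * X z - of_real (\<gamma> - Re q))"
  have X: "X 0 = 1" "(X has_field_derivative 2) (at 0)" "X holomorphic_on ball 0 1"
    using has_field_derivative_cayley[of 1] holomorphic_cayley[of 1] by (simp_all add: X_def)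
  have Y: "Y \<gamma> 0 = q" "(Y \<gamma> has_field_derivative 2 * (2 * of_real \<gamma> + \<i> * of_real (Im q))) (at 0)"
    "Y \<gamma> holomorphic_on ball 0 1" for \<gamma>
  proof -
    show "Y \<gamma> 0 = q" by (simp add: Y_def X complex_eq_iff)
    show "(Y \<gamma> has_field_derivative 2 * (2 * of_real \<gamma> + \<i> * of_real (Im q))) (at 0)"
      unfolding Y_def by (auto intro!: derivative_eq_intros X(2) simp: X(1))
    show "Y \<gamma> holomorphic_on ball 0 1" unfolding Y_def by (intro holomorphic_intros X(3))
  qed
  define P where "P = (\<lambda>\<gamma>. 0 \<le> \<gamma> \<and> \<gamma> < 1 \<and> (Im q)\<^sup>2 \<le> 4 * \<gamma> * (\<gamma> - Re q) \<and> 0 \<le> \<gamma> - Re q)"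
  have disc: "(X z, Y \<gamma> z) \<in> sym_half_plane" if "P \<gamma>" "norm z < 1" for \<gamma> z
    using that parabola_disc_in_sym_half_plane[of "X z" \<gamma> "Im q" "\<gamma> - Re q"] Re_cayley_pos[of z]
    by (simp add: P_def X_def Y_def)
  have sp: "norm (A + B * (2 * of_real \<gamma> + \<i> * of_real (Im q))) \<le> 1"
    "norm (A + B * (2 * of_real \<gamma> + \<i> * of_real (Im q))) = 1 \<Longrightarrow> norm z < 1 \<Longrightarrow>
      F (X z, Y \<gamma> z) = Moebius_function 0 (- w) ((A + B * (2 * of_real \<gamma> + \<i> * of_real (Im q))) * z)"
    if "P \<gamma>" for \<gamma> z
  proof -
    have dF': "(F has_derivative (\<lambda>h. a * fst h + b * snd h)) (at (X 0, Y \<gamma> 0))"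
      using dF by (simp add: X Y)
    have eq: "(a * 2 + b * (2 * (2 * of_real \<gamma> + \<i> * of_real (Im q)))) / of_real (1 - (norm (F (X 0, Y \<gamma> 0)))\<^sup>2)
      = A + B * (2 * of_real \<gamma> + \<i> * of_real (Im q))"
      by (simp add: X Y A_def B_def N_def w_def add_divide_distrib algebra_simps)
    note S = schwarz_pick_disc[OF F dF' X(3) Y(3) disc[OF that] X(2) Y(2), unfolded eq]
    show "norm (A + B * (2 * of_real \<gamma> + \<i> * of_real (Im q))) \<le> 1" by (rule S)
    show "norm (A + B * (2 * of_real \<gamma> + \<i> * of_real (Im q))) = 1 \<Longrightarrow> norm z < 1 \<Longrightarrow>
      F (X z, Y \<gamma> z) = Moebius_function 0 (- w) ((A + B * (2 * of_real \<gamma> + \<i> * of_real (Im q))) * z)"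
      using S(2)[of z] by (simp add: X Y w_def)
  qed
  \<comment> \<open>The interval extends only to the right of \<open>r / 2\<close>, because
    \<open>P\<close> excludes negative \<gamma> and \<open>r\<close> may be 0.\<close>
  have "\<exists>e>0. (\<forall>\<gamma>. r / 2 \<le> \<gamma> \<and> \<gamma> < r / 2 + e \<longrightarrow> P \<gamma>) \<and> B = 0"
  proof (cases "r = 0")
    case True
    hence q0: "Im q = 0" "Re q < 0" using dir(4) by (auto simp: r_def)
    have P: "P \<gamma>" if "0 \<le> \<gamma>" "\<gamma> < 1" for \<gamma>
      using that q0 by (simp add: P_def)
    define c where "c = sqrt (- Re q)"
    have c: "0 < c" "c\<^sup>2 = - Re q" using q0 by (auto simp: c_def)
    have qc: "q = (\<i> * of_real c)\<^sup>2"
      using q0 c by (simp add: complex_eq_iff power_mult_distrib Re_power2 Im_power2)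
    have AC: "A = C" using True q0 by (simp add: C_def dq)
    \<comment> \<open>The two half-plane points run through Cayley discs that are rotated
      independently and shifted by \<open>i c\<close> and \<open>- i c\<close>. They start at
      \<open>1 + i c\<close> and \<open>1 - i c\<close>, with half-difference \<open>i c\<close>, a
      square root of \<open>q\<close>.\<close>
    have bidisc: "norm (e1 * (A / 2 + \<i> * of_real c * B) + e2 * (A / 2 - \<i> * of_real c * B)) \<le> 1"
      if e: "norm e1 = 1" "norm e2 = 1" for e1 e2
    proof -
      define X1 X2 where "X1 = (\<lambda>z. \<i> * of_real c + (1 + e1 * z) / (1 - e1 * z))"
        and "X2 = (\<lambda>z. - \<i> * of_real c + (1 + e2 * z) / (1 - e2 * z))"
      have hol: "X1 holomorphic_on ball 0 1" "X2 holomorphic_on ball 0 1"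
        unfolding X1_def X2_def by (intro holomorphic_intros holomorphic_cayley e)+
      have d: "(X1 has_field_derivative 2 * e1) (at 0)" "(X2 has_field_derivative 2 * e2) (at 0)"
        unfolding X1_def X2_def
        by (rule DERIV_cong[OF DERIV_add[OF DERIV_const has_field_derivative_cayley]]; simp)+
      define U V where "U = (\<lambda>z. (X1 z + X2 z) / 2)" and "V = (\<lambda>z. ((X1 z - X2 z) / 2)\<^sup>2)"
      have 0: "X1 0 = 1 + \<i> * of_real c" "X2 0 = 1 - \<i> * of_real c" by (simp_all add: X1_def X2_def)
      hence UV0: "U 0 = 1" "V 0 = q" by (simp_all add: U_def V_def qc)
      have "U holomorphic_on ball 0 1" "V holomorphic_on ball 0 1"
        unfolding U_def V_def by (intro holomorphic_intros hol; simp)+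
      moreover have "(U has_field_derivative e1 + e2) (at 0)"
        unfolding U_def by (auto intro!: derivative_eq_intros d)
      moreover have "(V has_field_derivative 2 * \<i> * of_real c * (e1 - e2)) (at 0)"
        unfolding V_def by (auto intro!: derivative_eq_intros d simp: 0)
      moreover have "(U z, V z) \<in> sym_half_plane" if "norm z < 1" for z
      proof -
        have "0 < Re (X1 z)" "0 < Re (X2 z)"
          using Re_cayley_pos[of "e1 * z"] Re_cayley_pos[of "e2 * z"] that e
          by (simp_all add: X1_def X2_def norm_mult)
        thus ?thesis by (simp add: U_def V_def mem_sym_half_plane_square abs_less_iff)
      qed
      moreover have "(F has_derivative (\<lambda>h. a * fst h + b * snd h)) (at (U 0, V 0))"
        using dF by (simp add: UV0)
      ultimately have "norm ((a * (e1 + e2) + b * (2 * \<i> * of_real c * (e1 - e2))) /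
          of_real (1 - (norm (F (U 0, V 0)))\<^sup>2)) \<le> 1"
        using schwarz_pick_disc(1)[OF F] by blast
      also have "(a * (e1 + e2) + b * (2 * \<i> * of_real c * (e1 - e2))) /
          of_real (1 - (norm (F (U 0, V 0)))\<^sup>2) =
          e1 * (A / 2 + \<i> * of_real c * B) + e2 * (A / 2 - \<i> * of_real c * B)"
        using N by (simp add: UV0 w_def[symmetric] N_def[symmetric] A_def B_def field_simps)
      finally show ?thesis .
    qed
    have align: "\<exists>e. norm e = 1 \<and> e * z = of_real (norm z)" for z :: complex
    proof (cases "z = 0")
      case False
      thus ?thesis
        by (intro exI[of _ "of_real (norm z) / z"]) (simp add: norm_divide)
    qed (auto intro: exI[of _ 1])
    \<comment> \<open>These rotations make both terms nonnegative reals, so \<open>bidisc\<close>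
      bounds the sum of the two norms.\<close>
    obtain e1 e2 where e: "norm e1 = 1" "norm e2 = 1"
      "e1 * (A / 2 + \<i> * of_real c * B) = of_real (norm (A / 2 + \<i> * of_real c * B))"
      "e2 * (A / 2 - \<i> * of_real c * B) = of_real (norm (A / 2 - \<i> * of_real c * B))"
      using align by metis
    have "norm (A / 2 + \<i> * of_real c * B) + norm (A / 2 - \<i> * of_real c * B) =
        norm (of_real (norm (A / 2 + \<i> * of_real c * B) + norm (A / 2 - \<i> * of_real c * B)) :: complex)"
      by (simp only: norm_of_real) simp
    also have "\<dots> \<le> 1" using bidisc[OF e(1,2)] unfolding e(3,4) by simp
    finally have "norm (A / 2 + \<i> * of_real c * B) + norm (A / 2 - \<i> * of_real c * B) \<le> 1" .
    \<comment> \<open>For \<open>\<gamma> = 1 / 2\<close> and \<open>Im q = 0\<close> the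
      Schwarz-Pick constant is \<open>A + B\<close>.\<close>
    moreover have "norm (A + B) \<le> 1" using sp(1)[OF P, of "1 / 2"] q0 by simp
    ultimately have "B = 0"
      using eq_0_if_norm_sum_le[of A c B] C1 c(1) by (simp add: AC)
    with P True show ?thesis by (intro exI[of _ 1]) auto
  next
    case False
    hence r: "0 < r" "r < 2" "(Im q)\<^sup>2 < r * (r - 2 * Re q)"
      using dir by (auto simp: r_def)
    \<comment> \<open>The conditions at \<open>r / 2\<close> are strict here, so by continuity
      \<open>P\<close> holds on both sides of it.\<close>
    have "((\<lambda>\<gamma>. 4 * \<gamma> * (\<gamma> - Re q)) \<longlongrightarrow> 4 * (r / 2) * (r / 2 - Re q)) (nhds (r / 2))"
      by (intro tendsto_intros filterlim_ident)
    moreover have "(Im q)\<^sup>2 < 4 * (r / 2) * (r / 2 - Re q)" using r(3) by (simp add: algebra_simps)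
    ultimately have ev1: "\<forall>\<^sub>F \<gamma> in nhds (r / 2). (Im q)\<^sup>2 < 4 * \<gamma> * (\<gamma> - Re q)"
      by (rule order_tendstoD)
    have ev2: "\<forall>\<^sub>F \<gamma> in nhds (r / 2). \<gamma> \<in> {0<..<1}"
      using r by (intro eventually_nhds_in_open) auto
    have "\<forall>\<^sub>F \<gamma> in nhds (r / 2). P \<gamma>"
      using ev1 ev2
    proof eventually_elim
      case (elim \<gamma>)
      hence "0 < (4 * \<gamma>) * (\<gamma> - Re q)" by (smt (verit) zero_le_power2)
      thus ?case using elim by (simp add: P_def zero_less_mult_iff)
    qed
    then obtain e where e: "0 < e" "\<And>\<gamma>. dist \<gamma> (r / 2) < e \<Longrightarrow> P \<gamma>"
      unfolding eventually_nhds_metric by blast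
    have "B = 0"
    \<comment> \<open>At \<open>\<gamma> = r / 2 + t / 2\<close> the Schwarz-Pick constant is
      \<open>C + t B\<close>.\<close>
    proof (rule eq_0_if_norm_add_le_on_interval[OF C1])
      show "0 < 2 * e" using e by simp
      fix t :: real assume "\<bar>t\<bar> < 2 * e"
      hence "P (r / 2 + t / 2)" by (intro e(2)) (simp add: dist_real_def)
      from sp(1)[OF this] show "norm (C + of_real t * B) \<le> 1"
        by (simp add: C_def dq algebra_simps)
    qed
    with e show ?thesis by (intro exI[of _ e]) (auto simp: dist_real_def)
  qed
  then obtain e where e: "0 < e" "\<And>\<gamma>. r / 2 \<le> \<gamma> \<Longrightarrow> \<gamma> < r / 2 + e \<Longrightarrow> P \<gamma>" and B: "B = 0"
    by blast
  have A1: "norm A = 1" using C1 B by (simp add: C_def)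
  have holF: "F holomorphic2_on sym_half_plane" using F by (simp add: disc_maps_def)
  \<comment> \<open>Since \<open>B = 0\<close>, \<open>F\<close> is the same function of
    \<open>z\<close> on all the discs. Over a fixed \<open>x\<close> they sweep out a segment in the
    direction \<open>x^2 - 1\<close>. It degenerates at \<open>x = 1\<close>, where all discs pass
    through \<open>(1, q)\<close>; that fibre is reached by continuity in \<open>x\<close>.\<close>
  have off: "F (x, p) = Moebius_function 0 (- w) (A * ((x - 1) / (x + 1)))"
    if xp: "(x, p) \<in> sym_half_plane" and x1: "x \<noteq> 1" for x p
  proof -
    have x: "0 < Re x" using xp by (simp add: sym_half_plane_def)
    define z where "z = (x - 1) / (x + 1)"
    have z: "norm z < 1" using cayley_in_disc[OF x] by (simp add: z_def)
    have "x + 1 \<noteq> 0" using x by (auto simp: complex_eq_iff)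
    hence Xz: "X z = x" using cayley_inverse[of x] by (simp add: X_def z_def)
    show ?thesis
    proof (rule constant_on_fibre[OF holF _ e(1) _ xp])
      have "x\<^sup>2 - 1 = (x - 1) * (x + 1)" by (simp add: algebra_simps power2_eq_square)
      thus "x\<^sup>2 - 1 \<noteq> 0" using x1 \<open>x + 1 \<noteq> 0\<close> by simp
      fix t :: real assume t: "0 \<le> t" "t < e"
      hence P: "P (r / 2 + t)" by (intro e(2)) auto
      have "Y (r / 2) z + of_real t * (x\<^sup>2 - 1) = Y (r / 2 + t) z"
        by (simp add: Y_def Xz algebra_simps)
      thus "(x, Y (r / 2) z + of_real t * (x\<^sup>2 - 1)) \<in> sym_half_plane \<and>
          F (x, Y (r / 2) z + of_real t * (x\<^sup>2 - 1)) = Moebius_function 0 (- w) (A * ((x - 1) / (x + 1)))"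
        using disc[OF P z] sp(2)[OF P _ z] A1 B by (simp add: Xz z_def[symmetric])
    qed
  qed
  have at1: "F (1, p) = w" if p: "(1, p) \<in> sym_half_plane" for p
  proof (rule tendsto_unique)
    show "at (1::complex) \<noteq> bot" by simp
    have "complex_diff F (1, p)" using holF p by (auto simp: holomorphic2_on_iff)
    hence "isCont (\<lambda>x. F (x, p)) 1"
      using complex_diff_imp_partial(2) field_differentiable_imp_continuous_at by blast
    thus "((\<lambda>x. F (x, p)) \<longlongrightarrow> F (1, p)) (at 1)" by (simp add: isCont_def)
    have "((\<lambda>x. Moebius_function 0 (- w) (A * ((x - 1) / (x + 1)))) \<longlongrightarrow>
        (A * ((1 - 1) / (1 + 1)) - (- w)) / (1 - cnj (- w) * (A * ((1 - 1) / (1 + 1))))) (at 1)"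
      unfolding Moebius_function_simple by (intro tendsto_intros) auto
    hence lim: "((\<lambda>x. Moebius_function 0 (- w) (A * ((x - 1) / (x + 1)))) \<longlongrightarrow> w) (at 1)" by simp
    have "\<forall>\<^sub>F x in at 1. x \<in> {x. (x, p) \<in> sym_half_plane} - {1}"
      using p by (intro eventually_at_in_open open_sym_half_plane_fst) simp
    hence "\<forall>\<^sub>F x in at 1. Moebius_function 0 (- w) (A * ((x - 1) / (x + 1))) = F (x, p)"
      by eventually_elim (use off in auto)
    with lim show "((\<lambda>x. F (x, p)) \<longlongrightarrow> w) (at 1)"
      by (rule Lim_transform_eventually)
  qed
  have "F (x, p) = Moebius_function 0 (- w) (A * ((x - 1) / (x + 1)))"
    if "(x, p) \<in> sym_half_plane" for x p
    using off[OF that] at1 that by (cases "x = 1") (auto simp: Moebius_function_simple)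
  thus ?thesis using A1 w1 by (intro exI[of _ A] exI[of _ "- w"]) auto
qed

section \<open>Half-plane coordinates on the symmetrized bidisc\<close>

text \<open>At \<open>(z + w, z w)\<close> this is \<open>(1 - \<omega> z) (1 - \<omega> w)\<close>,
  the common denominator of the Cayley transforms of \<open>\<omega> z\<close> and
  \<open>\<omega> w\<close>.\<close>

definition hp_den :: "complex \<Rightarrow> complex \<times> complex \<Rightarrow> complex" where
  "hp_den \<omega> p = 1 - \<omega> * fst p + \<omega>\<^sup>2 * snd p"

text \<open>The arithmetic mean of these two Cayley transforms.\<close>

definition hp_mean :: "complex \<Rightarrow> complex \<times> complex \<Rightarrow> complex" where
  "hp_mean \<omega> p = (1 - \<omega>\<^sup>2 * snd p) / hp_den \<omega> p"

text \<open>
  For the point \<open>(z + w, z w)\<close> the quotient \<open>(1 + \<omega> s\<^sup>1 + \<omega>\<^sup>2 s\<^sup>2) / hp_den\<close> is the product of the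
  Cayley transforms of \<open>\<omega> z\<close> and \<open>\<omega> w\<close>.
\<close>
definition hp_disc :: "complex \<Rightarrow> complex \<times> complex \<Rightarrow> complex" where
  "hp_disc \<omega> p = (hp_mean \<omega> p)\<^sup>2 - (1 + \<omega> * fst p + \<omega>\<^sup>2 * snd p) / hp_den \<omega> p"

text \<open>The sum and the product of the disc points \<open>(X - 1) / (\<omega> (X + 1))\<close>
  for \<open>X = x + d\<close> and \<open>X = x - d\<close>; in both, \<open>d\<close> enters only
  through \<open>d^2\<close>, the second coordinate.\<close>

definition hp_inverse :: "complex \<Rightarrow> complex \<times> complex \<Rightarrow> complex \<times> complex" where
  "hp_inverse \<omega> p = (2 * ((fst p)\<^sup>2 - snd p - 1) / (\<omega> * ((fst p + 1)\<^sup>2 - snd p)),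
     ((fst p - 1)\<^sup>2 - snd p) / (\<omega>\<^sup>2 * ((fst p + 1)\<^sup>2 - snd p)))"

lemma one_minus_mult_nz:
  assumes "norm (\<omega>::complex) = 1" "norm z < 1"
  shows "1 - \<omega> * z \<noteq> 0"
proof
  assume "1 - \<omega> * z = 0"
  hence "norm (\<omega> * z) = 1" by (metis eq_iff_diff_eq_0 norm_one)
  thus False using assms by (simp add: norm_mult)
qed

lemma symmetrized_bidisc_cases:
  assumes "p \<in> symmetrized_bidisc"
  obtains z w where "p = (z + w, z * w)" "norm z < 1" "norm w < 1"
  using assms by (auto simp: symmetrized_bidisc_def)

lemma hp_den_nz:
  assumes "norm \<omega> = 1" "p \<in> symmetrized_bidisc"
  shows "hp_den \<omega> p \<noteq> 0"
proof -
  obtain z w where p: "p = (z + w, z * w)" "norm z < 1" "norm w < 1"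
    using assms(2) by (rule symmetrized_bidisc_cases)
  have "hp_den \<omega> p = (1 - \<omega> * z) * (1 - \<omega> * w)"
    by (simp add: hp_den_def p algebra_simps power2_eq_square)
  thus ?thesis using one_minus_mult_nz[OF assms(1)] p by simp
qed

lemma hp_coords_in_sym_half_plane:
  assumes \<omega>: "norm \<omega> = 1" and "p \<in> symmetrized_bidisc"
  shows "(hp_mean \<omega> p, hp_disc \<omega> p) \<in> sym_half_plane"
proof -
  obtain z w where p: "p = (z + w, z * w)" "norm z < 1" "norm w < 1"
    using assms(2) by (rule symmetrized_bidisc_cases)
  define X Y where "X = (1 + \<omega> * z) / (1 - \<omega> * z)" and "Y = (1 + \<omega> * w) / (1 - \<omega> * w)"
  have nz: "1 - \<omega> * z \<noteq> 0" "1 - \<omega> * w \<noteq> 0" using one_minus_mult_nz[OF \<omega>] p by auto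
  have den: "hp_den \<omega> p = (1 - \<omega> * z) * (1 - \<omega> * w)"
    by (simp add: hp_den_def p algebra_simps power2_eq_square)
  have m: "hp_mean \<omega> p = (X + Y) / 2"
  proof -
    have "X + Y = ((1 + \<omega> * z) * (1 - \<omega> * w) + (1 + \<omega> * w) * (1 - \<omega> * z)) / hp_den \<omega> p"
      unfolding X_def Y_def den using nz by (rule add_frac_eq)
    also have "(1 + \<omega> * z) * (1 - \<omega> * w) + (1 + \<omega> * w) * (1 - \<omega> * z) = 2 * (1 - \<omega>\<^sup>2 * snd p)"
      by (simp add: p(1) algebra_simps power2_eq_square)
    finally show ?thesis by (simp add: hp_mean_def del: right_diff_distrib_numeral)
  qed
  have XY: "(1 + \<omega> * fst p + \<omega>\<^sup>2 * snd p) / hp_den \<omega> p = X * Y"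
    unfolding den X_def Y_def by (simp add: p(1) algebra_simps power2_eq_square)
  have d: "hp_disc \<omega> p = ((X - Y) / 2)\<^sup>2"
    unfolding hp_disc_def m XY by (simp add: power2_eq_square field_simps)
  have "0 < Re X" "0 < Re Y"
    using Re_cayley_pos[of "\<omega> * z"] Re_cayley_pos[of "\<omega> * w"] p \<omega>
    by (simp_all add: X_def Y_def norm_mult)
  thus ?thesis by (simp add: m d mem_sym_half_plane_square abs_less_iff)
qed

lemma sym_half_plane_factor:
  assumes "(x, q) \<in> sym_half_plane"
  obtains d where "q = d\<^sup>2" "0 < Re (x + d)" "0 < Re (x - d)"
    "(x + 1)\<^sup>2 - q = (x + d + 1) * (x - d + 1)" "x + d + 1 \<noteq> 0" "x - d + 1 \<noteq> 0"
proof -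
  obtain d where d: "q = d\<^sup>2" "\<bar>Re d\<bar> < Re x"
    using sym_half_plane_cases[OF assms] .
  show ?thesis
  proof (rule that[of d])
    show pos: "0 < Re (x + d)" "0 < Re (x - d)" using d by auto
    thus "x + d + 1 \<noteq> 0" "x - d + 1 \<noteq> 0" by (auto simp: complex_eq_iff)
  qed (simp_all add: d algebra_simps power2_eq_square)
qed

lemma hp_inverse_in_symmetrized_bidisc:
  assumes \<omega>: "norm \<omega> = 1" and "(x, q) \<in> sym_half_plane"
  shows "hp_inverse \<omega> (x, q) \<in> symmetrized_bidisc"
proof -
  obtain d where d: "q = d\<^sup>2" "0 < Re (x + d)" "0 < Re (x - d)"
    "(x + 1)\<^sup>2 - q = (x + d + 1) * (x - d + 1)" "x + d + 1 \<noteq> 0" "x - d + 1 \<noteq> 0"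
    using sym_half_plane_factor[OF assms(2)] .
  define X Y where "X = x + d" and "Y = x - d"
  define z w where "z = (X - 1) / (\<omega> * (X + 1))" and "w = (Y - 1) / (\<omega> * (Y + 1))"
  have nz: "X + 1 \<noteq> 0" "Y + 1 \<noteq> 0" "\<omega> \<noteq> 0" using d \<omega> by (auto simp: X_def Y_def)
  have "norm z < 1" "norm w < 1"
    using cayley_in_disc[of X] cayley_in_disc[of Y] d \<omega>
    by (simp_all add: z_def w_def X_def Y_def norm_divide norm_mult)
  moreover have "hp_inverse \<omega> (x, q) = (z + w, z * w)"
  proof -
    have "z + w = ((X - 1) * (Y + 1) + (Y - 1) * (X + 1)) / (\<omega> * ((X + 1) * (Y + 1)))"
      unfolding z_def w_def add_divide_distrib using nz by simp
    also have "(X - 1) * (Y + 1) + (Y - 1) * (X + 1) = 2 * (x\<^sup>2 - q - 1)"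
      by (simp add: X_def Y_def d(1) algebra_simps power2_eq_square)
    finally have 1: "z + w = 2 * (x\<^sup>2 - q - 1) / (\<omega> * ((x + 1)\<^sup>2 - q))"
      unfolding d(4) by (simp add: X_def Y_def)
    have "z * w = ((X - 1) * (Y - 1)) / (\<omega>\<^sup>2 * ((X + 1) * (Y + 1)))"
      unfolding z_def w_def by (simp add: power2_eq_square ac_simps)
    also have "(X - 1) * (Y - 1) = (x - 1)\<^sup>2 - q"
      by (simp add: X_def Y_def d(1) algebra_simps power2_eq_square)
    finally have 2: "z * w = ((x - 1)\<^sup>2 - q) / (\<omega>\<^sup>2 * ((x + 1)\<^sup>2 - q))"
      unfolding d(4) by (simp add: X_def Y_def)
    show ?thesis by (simp add: hp_inverse_def 1 2)
  qed
  ultimately show ?thesis by (auto simp: symmetrized_bidisc_def)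
qed

text \<open>Multiplication by \<open>hp_den\<close> turns all the quotients into polynomials. The
  assumption concerns the denominator instead of membership, since the openness proof applies this
  to points not yet known to lie in the bidisc.\<close>

lemma hp_inverse_hp_coords:
  assumes \<omega>: "\<omega> \<noteq> 0" and den: "hp_den \<omega> p \<noteq> 0"
  shows "hp_inverse \<omega> (hp_mean \<omega> p, hp_disc \<omega> p) = p"
proof -
  define x q \<pi> where "x = hp_mean \<omega> p" and "q = hp_disc \<omega> p"
    and "\<pi> = (1 + \<omega> * fst p + \<omega>\<^sup>2 * snd p) / hp_den \<omega> p"
  have q: "q = x\<^sup>2 - \<pi>" by (simp add: q_def hp_disc_def x_def \<pi>_def)
  have m: "\<pi> * hp_den \<omega> p = 1 + \<omega> * fst p + \<omega>\<^sup>2 * snd p" "x * hp_den \<omega> p = 1 - \<omega>\<^sup>2 * snd p"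
    using den by (simp_all add: \<pi>_def x_def hp_mean_def)
  have "(\<pi> - 1) * hp_den \<omega> p = 2 * \<omega> * fst p"
    unfolding left_diff_distrib m by (simp add: hp_den_def)
  hence 1: "x\<^sup>2 - q - 1 = 2 * \<omega> * fst p / hp_den \<omega> p"
    using den by (simp add: q eq_divide_eq)
  have "(\<pi> + 2 * x + 1) * hp_den \<omega> p = 4"
    unfolding distrib_right mult.assoc m by (simp add: hp_den_def)
  moreover have "(x + 1)\<^sup>2 - q = \<pi> + 2 * x + 1"
    by (simp add: q power2_eq_square algebra_simps)
  ultimately have 2: "(x + 1)\<^sup>2 - q = 4 / hp_den \<omega> p"
    using den by (simp add: eq_divide_eq)
  have "(\<pi> - 2 * x + 1) * hp_den \<omega> p = 4 * \<omega>\<^sup>2 * snd p"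
    unfolding distrib_right left_diff_distrib mult.assoc m by (simp add: hp_den_def)
  moreover have "(x - 1)\<^sup>2 - q = \<pi> - 2 * x + 1"
    by (simp add: q power2_eq_square algebra_simps)
  ultimately have 3: "(x - 1)\<^sup>2 - q = 4 * \<omega>\<^sup>2 * snd p / hp_den \<omega> p"
    using den by (simp add: eq_divide_eq)
  show ?thesis
    unfolding x_def[symmetric] q_def[symmetric] hp_inverse_def fst_conv snd_conv 1 2 3
    using \<omega> den by (simp add: prod_eq_iff)
qed

lemma open_sym_half_plane: "open sym_half_plane"
proof -
  have "sym_half_plane = {p. 0 < Re (fst p) \<and>
      (Im (snd p))\<^sup>2 < 4 * (Re (fst p))\<^sup>2 * ((Re (fst p))\<^sup>2 - Re (snd p))}"
    by (auto simp: sym_half_plane_def)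
  also have "open \<dots>"
    by (intro open_Collect_conj open_Collect_less continuous_intros)
  finally show ?thesis .
qed

text \<open>On the open set where \<open>hp_den 1\<close> is nonzero, the bidisc is the preimage of
  \<open>sym_half_plane\<close> under the continuous half-plane coordinates;
  \<open>hp_inverse\<close> shows that the preimage contains nothing more.\<close>

lemma open_symmetrized_bidisc: "open symmetrized_bidisc"
proof -
  let ?S = "{p. hp_den 1 p \<noteq> 0}"
  let ?f = "\<lambda>p. (hp_mean 1 p, hp_disc 1 p)"
  have "open ?S" unfolding hp_den_def by (intro open_Collect_neq continuous_intros)
  moreover have "continuous_on ?S ?f"
    unfolding hp_disc_def hp_mean_def hp_den_def by (intro continuous_intros) auto
  ultimately have "open (?S \<inter> ?f -` sym_half_plane)"
    using open_sym_half_plane by (metis Int_commute continuous_on_open_vimage)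
  also have "?S \<inter> ?f -` sym_half_plane = symmetrized_bidisc"
  proof (intro equalityI subsetI)
    fix p assume "p \<in> ?S \<inter> ?f -` sym_half_plane"
    hence "hp_den 1 p \<noteq> 0" "(hp_mean 1 p, hp_disc 1 p) \<in> sym_half_plane" by auto
    thus "p \<in> symmetrized_bidisc"
      using hp_inverse_in_symmetrized_bidisc[of 1 "hp_mean 1 p" "hp_disc 1 p"]
        hp_inverse_hp_coords[of 1 p] by simp
  qed (simp add: hp_den_nz hp_coords_in_sym_half_plane)
  finally show ?thesis .
qed

lemma complex_diff_hp_coords:
  assumes "norm \<omega> = 1" "p \<in> symmetrized_bidisc"
  shows "complex_diff (hp_mean \<omega>) p" "complex_diff (hp_disc \<omega>) p"
proof -
  have "complex_diff (hp_den \<omega>) p"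
    unfolding hp_den_def[abs_def] by (intro complex_diff_rules)
  thus m: "complex_diff (hp_mean \<omega>) p"
    unfolding hp_mean_def[abs_def] by (intro complex_diff_rules hp_den_nz assms)
  show "complex_diff (hp_disc \<omega>) p"
    unfolding hp_disc_def[abs_def] by (intro complex_diff_rules hp_den_nz assms m \<open>complex_diff (hp_den \<omega>) p\<close>)
qed

section \<open>The functions \<open>Phi\<close> in half-plane coordinates\<close>

lemma two_minus_mult_nz:
  assumes "norm \<eta> = 1" "p \<in> symmetrized_bidisc"
  shows "2 - \<eta> * fst p \<noteq> 0"
proof -
  obtain z w where p: "p = (z + w, z * w)" "norm z < 1" "norm w < 1"
    using assms(2) by (rule symmetrized_bidisc_cases)
  have "norm (\<eta> * fst p) < 2"
    using norm_triangle_ineq[of z w] p assms(1) by (simp add: norm_mult)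
  thus ?thesis by auto
qed

text \<open>Over the denominator \<open>hp_den\<close>, the numerators of \<open>1 - hp_mean\<close>
  and \<open>1 + hp_mean\<close> are \<open>\<eta> (2 \<eta> s2 - s1)\<close> and
  \<open>2 - \<eta> s1\<close>; \<open>cnj \<eta>\<close> removes the extra \<eta>.\<close>

lemma Phi_eq_cayley_hp_mean:
  assumes \<eta>: "norm \<eta> = 1" and p: "p \<in> symmetrized_bidisc"
  shows "Phi \<eta> p = cnj \<eta> * ((1 - hp_mean \<eta> p) / (1 + hp_mean \<eta> p))"
proof -
  have den: "hp_den \<eta> p \<noteq> 0" using hp_den_nz[OF assms] .
  have "1 - hp_mean \<eta> p = (hp_den \<eta> p - (1 - \<eta>\<^sup>2 * snd p)) / hp_den \<eta> p"
    using den by (simp add: hp_mean_def diff_divide_distrib)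
  also have "\<dots> = \<eta> * (2 * \<eta> * snd p - fst p) / hp_den \<eta> p"
    by (simp add: hp_den_def algebra_simps power2_eq_square)
  finally have 1: "1 - hp_mean \<eta> p = \<dots>" .
  have "1 + hp_mean \<eta> p = (hp_den \<eta> p + (1 - \<eta>\<^sup>2 * snd p)) / hp_den \<eta> p"
    using den by (simp add: hp_mean_def add_divide_distrib)
  also have "\<dots> = (2 - \<eta> * fst p) / hp_den \<eta> p"
    by (simp add: hp_den_def)
  finally have 2: "1 + hp_mean \<eta> p = \<dots>" .
  have "cnj \<eta> * \<eta> = 1" using \<eta> complex_norm_square[of \<eta>] by (simp add: mult.commute)
  thus ?thesis
    unfolding 1 2 using den by (simp add: Phi_def split_beta mult.assoc[symmetric])
qed

lemma Re_hp_mean_pos: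
  assumes "norm \<omega> = 1" "p \<in> symmetrized_bidisc"
  shows "0 < Re (hp_mean \<omega> p)"
  using hp_coords_in_sym_half_plane[OF assms] by (simp add: sym_half_plane_def)

lemma Phi_in_disc_maps:
  assumes \<eta>: "norm \<eta> = 1"
  shows "Phi \<eta> \<in> disc_maps symmetrized_bidisc"
proof -
  have "complex_diff (Phi \<eta>) p" if p: "p \<in> symmetrized_bidisc" for p
    unfolding Phi_def split_beta
    by (intro complex_diff_rules two_minus_mult_nz \<eta> p)
  moreover have "norm (Phi \<eta> p) < 1" if p: "p \<in> symmetrized_bidisc" for p
  proof -
    have "norm ((1 - hp_mean \<eta> p) / (1 + hp_mean \<eta> p)) = norm ((hp_mean \<eta> p - 1) / (hp_mean \<eta> p + 1))"
      by (simp add: norm_divide norm_minus_commute add.commute)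
    also have "\<dots> < 1" by (intro cayley_in_disc Re_hp_mean_pos \<eta> p)
    finally show ?thesis
      using \<eta> by (simp add: Phi_eq_cayley_hp_mean[OF \<eta> p] norm_mult norm_divide)
  qed
  ultimately show ?thesis by (simp add: disc_maps_def holomorphic2_on_iff)
qed

lemma directional_deriv_cong_open:
  assumes "open S" "p \<in> S" "\<And>x. x \<in> S \<Longrightarrow> F x = G x" "complex_diff G p"
  shows "directional_deriv v F p = directional_deriv v G p"
proof -
  obtain a b where d: "(G has_derivative (\<lambda>h. a * fst h + b * snd h)) (at p)"
    using assms(4) unfolding complex_diff_def by blast
  have "(F has_derivative (\<lambda>h. a * fst h + b * snd h)) (at p)"
    using has_derivative_transform_within_open[OF d assms(1,2)] assms(3) by metis
  thus ?thesis using d by (simp add: directional_deriv_eq)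
qed

lemma directional_deriv_compose2:
  assumes "(F has_derivative (\<lambda>h. A * fst h + B * snd h)) (at (f p, g p))"
    and "complex_diff f p" "complex_diff g p"
  shows "directional_deriv v (\<lambda>p. F (f p, g p)) p =
      A * directional_deriv v f p + B * directional_deriv v g p"
  using has_derivative_compose2[OF assms] directional_deriv_eq by metis

text \<open>A conformal map from the half-plane to the disc turns the hyperbolic density
  \<open>1 / (1 - |z|^2)\<close> into \<open>1 / (2 Re x)\<close>; in the computation the powers of
  \<open>|1 + x|\<close> cancel.\<close>

lemma car_quotient_Phi:
  assumes \<eta>: "norm \<eta> = 1" and p: "p \<in> symmetrized_bidisc"
  shows "car_quotient (Phi \<eta>) (p, v) =
      norm (directional_deriv v (hp_mean \<eta>) p) / (2 * Re (hp_mean \<eta> p))"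
proof -
  define x where "x = hp_mean \<eta> p"
  define D where "D = directional_deriv v (hp_mean \<eta>) p"
  have x: "0 < Re x" using Re_hp_mean_pos[OF assms] by (simp add: x_def)
  have nz: "1 + x \<noteq> 0" using x by (auto simp: complex_eq_iff)
  have m: "complex_diff (hp_mean \<eta>) p" by (intro complex_diff_hp_coords assms)
  \<comment> \<open>\<open>H\<close> ignores its second argument, so the two-variable chain rule
    applies with \<open>hp_mean\<close> in both places.\<close>
  define H where "H = (\<lambda>q::complex \<times> complex. cnj \<eta> * ((1 - fst q) / (1 + fst q)))"
  have "((\<lambda>x. cnj \<eta> * ((1 - x) / (1 + x))) has_field_derivative cnj \<eta> * (- 2 / (1 + x)\<^sup>2)) (at x)"
    using nz by (auto intro!: derivative_eq_intros simp: field_simps power2_eq_square)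
  hence "((\<lambda>x. cnj \<eta> * ((1 - x) / (1 + x))) has_derivative (*) (cnj \<eta> * (- 2 / (1 + x)\<^sup>2))) (at (fst (x, x)))"
    by (simp add: has_field_derivative_def)
  from has_derivative_compose[OF has_derivative_fst[OF has_derivative_ident] this]
  have dH: "(H has_derivative (\<lambda>h. cnj \<eta> * (- 2 / (1 + x)\<^sup>2) * fst h + 0 * snd h))
      (at (hp_mean \<eta> p, hp_mean \<eta> p))"
    by (simp add: H_def x_def)
  have HC: "complex_diff (\<lambda>q. H (hp_mean \<eta> q, hp_mean \<eta> q)) p"
    by (rule complex_diff_compose2[OF _ m m]) (use dH in \<open>unfold complex_diff_def, blast\<close>)
  have "directional_deriv v (Phi \<eta>) p = directional_deriv v (\<lambda>q. H (hp_mean \<eta> q, hp_mean \<eta> q)) p"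
    by (rule directional_deriv_cong_open[OF open_symmetrized_bidisc p _ HC])
       (simp add: Phi_eq_cayley_hp_mean[OF \<eta>] H_def)
  also have "\<dots> = cnj \<eta> * (- 2 / (1 + x)\<^sup>2) * D"
    unfolding directional_deriv_compose2[OF dH m m] by (simp add: D_def)
  finally have dPhi: "norm (directional_deriv v (Phi \<eta>) p) = 2 * norm D / (norm (1 + x))\<^sup>2"
    using \<eta> by (simp add: norm_mult norm_divide norm_power)
  have PhiM: "1 - (norm (Phi \<eta> p))\<^sup>2 = 4 * Re x / (norm (1 + x))\<^sup>2"
  proof -
    have "(norm (Phi \<eta> p))\<^sup>2 = (norm (1 - x))\<^sup>2 / (norm (1 + x))\<^sup>2"
      using \<eta> by (simp add: Phi_eq_cayley_hp_mean[OF \<eta> p] x_def norm_mult norm_divide power_divide)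
    moreover have "4 * Re x = (norm (1 + x))\<^sup>2 - (norm (1 - x))\<^sup>2"
      unfolding cmod_power2 by (simp add: power2_eq_square algebra_simps)
    moreover have "norm (1 + x) \<noteq> 0" using nz by simp
    ultimately show ?thesis by (simp add: diff_divide_distrib)
  qed
  show ?thesis
    unfolding car_quotient_def fst_conv snd_conv dPhi PhiM using nz
    by (simp add: D_def x_def)
qed

text \<open>Replacing \<omega> by \<eta> acts on each Cayley transform by the half-plane
  automorphism \<open>X \<mapsto> - i \<tau> + (1 + \<tau>^2) / (X - i \<tau>)\<close>. Averaging
  over \<open>X = x + d\<close> and \<open>X = x - d\<close> gives the formula. As \<tau> runs
  through the reals, \<eta> runs through the circle without \<omega>.\<close>

lemma hp_mean_rotate:
  fixes \<tau> :: real
  assumes \<omega>: "norm \<omega> = 1" and p: "p \<in> symmetrized_bidisc"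
  defines "\<eta> \<equiv> - \<omega> * ((1 + \<i> * of_real \<tau>) / (1 - \<i> * of_real \<tau>))"
  defines "y \<equiv> hp_mean \<omega> p - \<i> * of_real \<tau>"
  shows "norm \<eta> = 1" and "\<eta> \<noteq> \<omega>" and "y\<^sup>2 - hp_disc \<omega> p \<noteq> 0"
    and "hp_mean \<eta> p = - \<i> * of_real \<tau> + of_real (1 + \<tau>\<^sup>2) * (y / (y\<^sup>2 - hp_disc \<omega> p))"
proof -
  define T where "T = \<i> * of_real \<tau>"
  have T: "of_real (1 + \<tau>\<^sup>2) = (1 - T) * (1 + T)"
    by (simp add: T_def complex_eq_iff power2_eq_square algebra_simps)
  have k: "1 - T \<noteq> 0" by (simp add: T_def complex_eq_iff)
  have "norm (1 + T) = norm (1 - T)" by (simp add: T_def cmod_def)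
  thus \<eta>: "norm \<eta> = 1" using \<omega> k by (simp add: \<eta>_def T_def[symmetric] norm_mult norm_divide)
  have \<eta>k: "\<eta> * (1 - T) = - \<omega> * (1 + T)" using k by (simp add: \<eta>_def T_def[symmetric])
  show "\<eta> \<noteq> \<omega>"
  proof
    assume "\<eta> = \<omega>"
    with \<eta>k have "2 * \<omega> = 0" by (simp add: algebra_simps)
    thus False using \<omega> by auto
  qed
  note den = hp_den_nz[OF \<omega> p] and den' = hp_den_nz[OF \<eta> p]
  define x q where "x = hp_mean \<omega> p" and "q = hp_disc \<omega> p"
  have x: "x * hp_den \<omega> p = 1 - \<omega>\<^sup>2 * snd p" using den by (simp add: x_def hp_mean_def)
  have y: "y = x - T" by (simp add: y_def x_def T_def)
  have \<eta>2: "(1 - T)\<^sup>2 * hp_den \<eta> p = (1 - T)\<^sup>2 + (1 - T) * (1 + T) * \<omega> * fst p + (1 + T)\<^sup>2 * \<omega>\<^sup>2 * snd p"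
  proof -
    have "(1 - T)\<^sup>2 * hp_den \<eta> p =
        (1 - T)\<^sup>2 - (1 - T) * (\<eta> * (1 - T)) * fst p + (\<eta> * (1 - T))\<^sup>2 * snd p"
      by (simp add: hp_den_def algebra_simps power2_eq_square)
    thus ?thesis unfolding \<eta>k by (simp add: algebra_simps power2_eq_square)
  qed
  \<comment> \<open>Both denominators are nonzero, so this identity gives
    \<open>y^2 - q \<noteq> 0\<close> and allows the mean for \<eta> to be computed over the
    denominator for \<omega>.\<close>
  have yq: "(y\<^sup>2 - q) * hp_den \<omega> p = (1 - T)\<^sup>2 * hp_den \<eta> p"
  proof -
    define \<pi> where "\<pi> = (1 + \<omega> * fst p + \<omega>\<^sup>2 * snd p) / hp_den \<omega> p"
    have \<pi>: "\<pi> * hp_den \<omega> p = 1 + \<omega> * fst p + \<omega>\<^sup>2 * snd p" using den by (simp add: \<pi>_def)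
    have "y\<^sup>2 - q = \<pi> - 2 * T * x + T\<^sup>2"
      by (simp add: y q_def hp_disc_def x_def[symmetric] \<pi>_def power2_eq_square algebra_simps)
    hence "(y\<^sup>2 - q) * hp_den \<omega> p =
        \<pi> * hp_den \<omega> p - 2 * T * (x * hp_den \<omega> p) + T\<^sup>2 * hp_den \<omega> p"
      by (simp only: distrib_right left_diff_distrib mult.assoc)
    also have "\<dots> = (1 - T)\<^sup>2 * hp_den \<eta> p"
      unfolding \<pi> x \<eta>2 by (simp add: hp_den_def power2_eq_square algebra_simps)
    finally show ?thesis .
  qed
  thus nz: "y\<^sup>2 - hp_disc \<omega> p \<noteq> 0" using den den' k by (auto simp: q_def)
  have "(hp_mean \<eta> p * (y\<^sup>2 - q)) * hp_den \<omega> p =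
      (1 - T)\<^sup>2 * (hp_mean \<eta> p * hp_den \<eta> p)"
    using yq by (simp add: ac_simps)
  also have "hp_mean \<eta> p * hp_den \<eta> p = 1 - \<eta>\<^sup>2 * snd p"
    using den' by (simp add: hp_mean_def)
  also have "(1 - T)\<^sup>2 * (1 - \<eta>\<^sup>2 * snd p) = (1 - T)\<^sup>2 - (\<eta> * (1 - T))\<^sup>2 * snd p"
    by (simp add: algebra_simps power2_eq_square)
  also have "\<dots> = (1 - T)\<^sup>2 - (1 + T)\<^sup>2 * \<omega>\<^sup>2 * snd p"
    unfolding \<eta>k by (simp add: power2_eq_square)
  also have "\<dots> = - T * ((y\<^sup>2 - q) * hp_den \<omega> p) +
      (1 - T) * (1 + T) * (x * hp_den \<omega> p - T * hp_den \<omega> p)"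
    unfolding yq \<eta>2 x by (simp add: hp_den_def power2_eq_square algebra_simps)
  also have "\<dots> = (- T * (y\<^sup>2 - q) + (1 - T) * (1 + T) * y) * hp_den \<omega> p"
    by (simp add: y algebra_simps)
  finally have "hp_mean \<eta> p * (y\<^sup>2 - q) = - T * (y\<^sup>2 - q) + (1 - T) * (1 + T) * y"
    using den by simp
  hence "hp_mean \<eta> p = (- T * (y\<^sup>2 - q) + (1 - T) * (1 + T) * y) / (y\<^sup>2 - q)"
    using nz by (simp add: q_def eq_divide_eq)
  also have "\<dots> = - T + (1 - T) * (1 + T) * (y / (y\<^sup>2 - q))"
    using nz by (simp add: diff_divide_distrib q_def)
  finally show "hp_mean \<eta> p = - \<i> * of_real \<tau> + of_real (1 + \<tau>\<^sup>2) * (y / (y\<^sup>2 - hp_disc \<omega> p))"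
    unfolding T by (simp add: T_def q_def)
qed

text \<open>Up to a constant and the factor \<open>1 + \<tau>^2\<close>, the mean for \<eta> is
  \<open>y / (y^2 - q)\<close>. Its real part is \<open>R / |y^2 - q|^2\<close> and its derivative
  is \<open>- ((y^2 + q) dx - y dq) / (y^2 - q)^2\<close>; the common factors cancel in the
  quotient.\<close>

lemma car_quotient_Phi_rotate:
  fixes \<tau> :: real and v :: "complex \<times> complex"
  assumes \<omega>: "norm \<omega> = 1" and p: "p \<in> symmetrized_bidisc"
  defines "\<eta> \<equiv> - \<omega> * ((1 + \<i> * of_real \<tau>) / (1 - \<i> * of_real \<tau>))"
    and "y \<equiv> hp_mean \<omega> p - \<i> * of_real \<tau>" and "q \<equiv> hp_disc \<omega> p"
  defines "R \<equiv> Re (hp_mean \<omega> p) * (norm y)\<^sup>2 - Re (y * cnj q)"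
  shows "0 < R" and "car_quotient (Phi \<eta>) (p, v) =
    norm ((y\<^sup>2 + q) * directional_deriv v (hp_mean \<omega>) p - y * directional_deriv v (hp_disc \<omega>) p) / (2 * R)"
proof -
  note rot = hp_mean_rotate[OF \<omega> _, of _ \<tau>, folded \<eta>_def]
  have \<eta>: "norm \<eta> = 1" using rot(1)[OF p] .
  have nz: "y\<^sup>2 - q \<noteq> 0" using rot(3)[OF p] by (simp add: y_def q_def)
  define k where "k = 1 + \<tau>\<^sup>2"
  have k: "0 < k" by (simp add: k_def add_pos_nonneg)
  have "Re (y / (y\<^sup>2 - q)) = Re (y * cnj (y\<^sup>2 - q)) / (norm (y\<^sup>2 - q))\<^sup>2"
    by (metis Re_divide_of_real complex_div_cnj of_real_power)
  also have "Re (y * cnj (y\<^sup>2 - q)) = R"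
    unfolding R_def cmod_power2
    by (simp add: y_def Re_power2 Im_power2 algebra_simps power2_eq_square)
  finally have *: "Re (y / (y\<^sup>2 - q)) = R / (norm (y\<^sup>2 - q))\<^sup>2" .
  have Re: "Re (hp_mean \<eta> p) = k * R / (norm (y\<^sup>2 - q))\<^sup>2"
  proof -
    have "hp_mean \<eta> p = - \<i> * of_real \<tau> + of_real k * (y / (y\<^sup>2 - q))"
      using rot(4)[OF p] by (simp only: k_def y_def q_def)
    hence "Re (hp_mean \<eta> p) = k * Re (y / (y\<^sup>2 - q))"
      by (simp del: times_divide_eq_right)
    thus ?thesis by (simp add: *)
  qed
  with Re_hp_mean_pos[OF \<eta> p] k show R: "0 < R"
    by (simp add: zero_less_divide_iff zero_less_mult_iff not_less)
  define K where "K = (\<lambda>h. - \<i> * of_real \<tau> +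
      of_real k * ((fst h - \<i> * of_real \<tau>) / ((fst h - \<i> * of_real \<tau>)\<^sup>2 - snd h)))"
  define dx dq where "dx = directional_deriv v (hp_mean \<omega>) p"
    and "dq = directional_deriv v (hp_disc \<omega>) p"
  have num: "((\<lambda>h::complex \<times> complex. fst h - \<i> * of_real \<tau>) has_derivative fst) (at (hp_mean \<omega> p, q))"
    by (auto intro!: derivative_eq_intros)
  have den: "((\<lambda>h::complex \<times> complex. (fst h - \<i> * of_real \<tau>)\<^sup>2 - snd h) has_derivative
      (\<lambda>h. 2 * y * fst h - snd h)) (at (hp_mean \<omega> p, q))"
    by (auto intro!: derivative_eq_intros simp: y_def)
  have "(K has_derivative (\<lambda>h. of_real k * ((fst h * (y\<^sup>2 - q) - y * (2 * y * fst h - snd h)) /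
      ((y\<^sup>2 - q) * (y\<^sup>2 - q))))) (at (hp_mean \<omega> p, q))"
    unfolding K_def
    by (rule has_derivative_eq_rhs[OF has_derivative_add[OF has_derivative_const
          has_derivative_mult_right[OF has_derivative_divide'[OF num den]]]])
       (use nz in \<open>simp_all add: y_def\<close>)
  also have "(\<lambda>h. of_real k * ((fst h * (y\<^sup>2 - q) - y * (2 * y * fst h - snd h)) /
      ((y\<^sup>2 - q) * (y\<^sup>2 - q)))) =
      (\<lambda>h. (of_real k * (- (y\<^sup>2 + q)) / (y\<^sup>2 - q)\<^sup>2) * fst h + (of_real k * y / (y\<^sup>2 - q)\<^sup>2) * snd h)"
  proof
    fix h :: "complex \<times> complex"
    have "fst h * (y\<^sup>2 - q) - y * (2 * y * fst h - snd h) = - (y\<^sup>2 + q) * fst h + y * snd h"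
      by (simp add: algebra_simps power2_eq_square)
    thus "of_real k * ((fst h * (y\<^sup>2 - q) - y * (2 * y * fst h - snd h)) / ((y\<^sup>2 - q) * (y\<^sup>2 - q))) =
      (of_real k * (- (y\<^sup>2 + q)) / (y\<^sup>2 - q)\<^sup>2) * fst h + (of_real k * y / (y\<^sup>2 - q)\<^sup>2) * snd h"
      by (simp only: power2_eq_square[of "y\<^sup>2 - q"] add_divide_distrib distrib_left
          times_divide_eq_left times_divide_eq_right mult.assoc)
  qed
  finally have dK: "(K has_derivative (\<lambda>h. (of_real k * (- (y\<^sup>2 + q)) / (y\<^sup>2 - q)\<^sup>2) * fst h +
      (of_real k * y / (y\<^sup>2 - q)\<^sup>2) * snd h)) (at (hp_mean \<omega> p, hp_disc \<omega> p))"
    by (simp only: q_def)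
  note m = complex_diff_hp_coords[OF \<omega> p]
  have KC: "complex_diff (\<lambda>p. K (hp_mean \<omega> p, hp_disc \<omega> p)) p"
    by (rule complex_diff_compose2[OF _ m]) (use dK in \<open>unfold complex_diff_def, blast\<close>)
  have "directional_deriv v (hp_mean \<eta>) p =
      directional_deriv v (\<lambda>p. K (hp_mean \<omega> p, hp_disc \<omega> p)) p"
    by (rule directional_deriv_cong_open[OF open_symmetrized_bidisc p _ KC])
       (simp add: rot(4) K_def k_def)
  also have "\<dots> = (of_real k * (- (y\<^sup>2 + q)) / (y\<^sup>2 - q)\<^sup>2) * dx + (of_real k * y / (y\<^sup>2 - q)\<^sup>2) * dq"
    unfolding directional_deriv_compose2[OF dK m] by (simp add: dx_def dq_def)
  also have "\<dots> = - (of_real k * ((y\<^sup>2 + q) * dx - y * dq)) / (y\<^sup>2 - q)\<^sup>2"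
    by (simp add: add_divide_distrib[symmetric] algebra_simps)
  finally have D: "norm (directional_deriv v (hp_mean \<eta>) p) =
      k * norm ((y\<^sup>2 + q) * dx - y * dq) / (norm (y\<^sup>2 - q))\<^sup>2"
    using k by (simp add: norm_divide norm_mult norm_power)
  show "car_quotient (Phi \<eta>) (p, v) = norm ((y\<^sup>2 + q) * dx - y * dq) / (2 * R)"
    unfolding car_quotient_Phi[OF \<eta> p] D Re using k nz by simp
qed

lemma solves_CarD:
  assumes "solves_Car S F \<delta>"
  shows "F \<in> disc_maps S" and "ereal (car_quotient F \<delta>) = car_norm S \<delta>"
  using assms by (simp_all add: solves_Car_def)

lemma car_quotient_less_if_not_solves:
  assumes "solves_Car S F \<delta>" "G \<in> disc_maps S" "\<not> solves_Car S G \<delta>"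
  shows "car_quotient G \<delta> < car_quotient F \<delta>"
proof -
  have "ereal (car_quotient G \<delta>) \<le> car_norm S \<delta>"
    unfolding car_norm_def using assms(2) by (rule SUP_upper)
  moreover have "ereal (car_quotient G \<delta>) \<noteq> car_norm S \<delta>"
    using assms(2,3) by (simp add: solves_Car_def)
  ultimately show ?thesis using solves_CarD(2)[OF assms(1)] by (metis ereal_less_eq(3) less_le)
qed

text \<open>As functions of \<open>x\<close>, \<open>(x - a) / (x + cnj a)\<close> and
  \<open>Moebius_function 0 Z0 Z\<close> both map the half-plane conformally onto the disc and
  vanish at \<open>a\<close>, so they differ by a constant of modulus 1.\<close>

lemma cayley_difference_as_Moebius:
  fixes a x :: complex
  assumes a: "0 < Re a" and x: "0 < Re x"
  defines "Z0 \<equiv> (1 - a) / (1 + a)" and "Z \<equiv> (1 - x) / (1 + x)"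
  shows "(x - a) / (x + cnj a) = - ((1 + a) / (1 + cnj a)) * Moebius_function 0 Z0 Z"
proof -
  have nz: "1 + a \<noteq> 0" "1 + cnj a \<noteq> 0" "1 + x \<noteq> 0" "x + cnj a \<noteq> 0"
    using a x by (auto simp: complex_eq_iff)
  have "Z - Z0 = ((1 - x) * (1 + a) - (1 - a) * (1 + x)) / ((1 + x) * (1 + a))"
    unfolding Z_def Z0_def using nz by (simp add: diff_frac_eq)
  also have "(1 - x) * (1 + a) - (1 - a) * (1 + x) = - 2 * (x - a)"
    by (simp add: algebra_simps)
  finally have 1: "Z - Z0 = - 2 * (x - a) / ((1 + x) * (1 + a))" .
  have "cnj Z0 * Z = (1 - cnj a) * (1 - x) / ((1 + x) * (1 + cnj a))"
    by (simp add: Z_def Z0_def mult.commute)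
  hence "1 - cnj Z0 * Z = ((1 + cnj a) * (1 + x) - (1 - cnj a) * (1 - x)) / ((1 + x) * (1 + cnj a))"
    using nz by (simp add: diff_divide_distrib)
  also have "(1 + cnj a) * (1 + x) - (1 - cnj a) * (1 - x) = 2 * (x + cnj a)"
    by (simp add: algebra_simps)
  finally have 2: "1 - cnj Z0 * Z = 2 * (x + cnj a) / ((1 + x) * (1 + cnj a))" .
  show ?thesis
    unfolding Moebius_function_simple 1 2 using nz
    by (simp add: divide_simps del: distrib_left_numeral right_diff_distrib_numeral)
qed

theorem theorem2p1:
  fixes \<delta> :: tangent and \<omega> :: complex and \<psi> :: "complex \<times> complex \<Rightarrow> complex"
  assumes "\<delta> \<in> tangents symmetrized_bidisc"
    and "nondegenerate \<delta>"
    and "\<exists>!\<eta>. \<eta> \<in> sphere 0 1 \<and> solves_Car symmetrized_bidisc (Phi \<eta>) \<delta>"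
    and "\<omega> \<in> sphere 0 1"
    and "solves_Car symmetrized_bidisc (Phi \<omega>) \<delta>"
    and "solves_Car symmetrized_bidisc \<psi> \<delta>"
  shows "\<exists>m. disc_automorphism m \<and> (\<forall>p\<in>symmetrized_bidisc. \<psi> p = m (Phi \<omega> p))"
proof -
  obtain p v where \<delta>: "\<delta> = (p, v)" and p: "p \<in> symmetrized_bidisc"
    using assms(1) by (auto simp: tangents_def)
  have \<omega>: "norm \<omega> = 1" "\<omega> \<noteq> 0" using assms(4) by auto
  have \<psi>: "\<psi> \<in> disc_maps symmetrized_bidisc" using solves_CarD(1)[OF assms(6)] .

  \<comment> \<open>Normalization of the base point\<close>
  define a q' where "a = hp_mean \<omega> p" and "q' = hp_disc \<omega> p"
  define u t where "u = Re a" and "t = Im a"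
  have a: "a = of_real u + \<i> * of_real t" by (simp add: u_def t_def complex_eq_iff)
  have u: "0 < u" using Re_hp_mean_pos[OF \<omega>(1) p] by (simp add: u_def a_def)
  define q where "q = q' / of_real (u\<^sup>2)"
  have q': "q' = of_real (u\<^sup>2) * q" using u by (simp add: q_def)
  have normalize: "((x - \<i> * of_real t) / of_real u, y / of_real (u\<^sup>2)) \<in> sym_half_plane"
    if "(x, y) \<in> sym_half_plane" for x y
    using sym_half_plane_affine[OF that, of "1 / u" "- t / u"] u
    by (simp add: diff_divide_distrib power_divide)
  have a1: "(a - \<i> * of_real t) / of_real u = 1" using u by (simp add: a)
  have base: "(1, q) \<in> sym_half_plane"
    using normalize[OF hp_coords_in_sym_half_plane[OF \<omega>(1) p]] a1 by (simp add: a_def q_def q'_def)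
  define dx dq' where "dx = directional_deriv v (hp_mean \<omega>) p"
    and "dq' = directional_deriv v (hp_disc \<omega>) p"
  \<comment> \<open>In normalized coordinates the tangent is \<open>(dx / u, dq' / u^2)\<close>,
    which is \<open>dx / u\<close> times \<open>(1, dq)\<close> once \<open>dx \<noteq> 0\<close> is
    known.\<close>
  define dq where "dq = dq' / (dx * of_real u)"
  have Phi\<omega>: "car_quotient (Phi \<omega>) \<delta> = norm dx / (2 * u)"
    by (simp add: \<delta> car_quotient_Phi[OF \<omega>(1) p] dx_def u_def a_def)

  \<comment> \<open>Strict inequalities against the other functions \<open>Phi\<close>\<close>
  have strict0: "0 < u * (norm y)\<^sup>2 - Re (y * cnj q') \<and>
      norm ((y\<^sup>2 + q') * dx - y * dq') / (2 * (u * (norm y)\<^sup>2 - Re (y * cnj q'))) < norm dx / (2 * u)"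
    if y: "y = a - \<i> * of_real \<tau>" for y and \<tau> :: real
  proof -
    define \<eta> where "\<eta> = - \<omega> * ((1 + \<i> * of_real \<tau>) / (1 - \<i> * of_real \<tau>))"
    have \<eta>: "norm \<eta> = 1" "\<eta> \<noteq> \<omega>" using hp_mean_rotate(1,2)[OF \<omega>(1) p, of \<tau>, folded \<eta>_def] .
    hence "\<not> solves_Car symmetrized_bidisc (Phi \<eta>) \<delta>"
      using assms(3,4,5) by (metis dist_0_norm mem_sphere)
    hence "car_quotient (Phi \<eta>) \<delta> < norm dx / (2 * u)"
      using car_quotient_less_if_not_solves[OF assms(5) Phi_in_disc_maps[OF \<eta>(1)]]
      unfolding Phi\<omega> by blast
    thus ?thesis
      using car_quotient_Phi_rotate[OF \<omega>(1) p, of \<tau>]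
      unfolding \<delta> by (simp only: \<eta>_def y a_def q'_def dx_def dq'_def u_def simp_thms)
  qed
  \<comment> \<open>The comparison at \<open>\<tau> = 0\<close> puts a nonnegative number strictly
    below \<open>norm dx / (2 * u)\<close>, whence \<open>dx \<noteq> 0\<close>.\<close>
  have "a = a - \<i> * of_real 0" by simp
  note at0 = strict0[OF this]
  have "0 \<le> norm ((a\<^sup>2 + q') * dx - a * dq') / (2 * (u * (norm a)\<^sup>2 - Re (a * cnj q')))"
    by (intro divide_nonneg_pos norm_ge_zero mult_pos_pos conjunct1[OF at0]) simp
  hence "0 < norm dx / (2 * u)" using conjunct2[OF at0] by linarith
  hence dx: "dx \<noteq> 0" by auto
  have strict: "norm ((1 - \<i> * of_real \<tau>)\<^sup>2 + q - (1 - \<i> * of_real \<tau>) * dq) <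
      (norm (1 - \<i> * of_real \<tau>))\<^sup>2 - Re ((1 - \<i> * of_real \<tau>) * cnj q)" for \<tau> :: real
  proof -
    define y where "y = 1 - \<i> * of_real \<tau>"
    define N R where "N = norm (y\<^sup>2 + q - y * dq)" and "R = (norm y)\<^sup>2 - Re (y * cnj q)"
    \<comment> \<open>Undoing the normalization multiplies \<open>y\<close> by \<open>u\<close>,
      which turns the parameter \<tau> into \<open>t + u * \<tau>\<close>.\<close>
    have uy: "of_real u * y = a - \<i> * of_real (t + u * \<tau>)"
      by (simp add: y_def a algebra_simps)
    have R: "u * (norm (of_real u * y))\<^sup>2 - Re (of_real u * y * cnj q') = u ^ 3 * R"
      using u by (simp add: R_def q' norm_mult power_mult_distrib power2_eq_square power3_eq_cube
          algebra_simps)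
    have "dq' = dx * of_real u * dq" using dx u by (simp add: dq_def)
    hence "((of_real u * y)\<^sup>2 + q') * dx - of_real u * y * dq' = of_real (u\<^sup>2) * dx * (y\<^sup>2 + q - y * dq)"
      by (simp add: q' power2_eq_square algebra_simps)
    hence N: "norm (((of_real u * y)\<^sup>2 + q') * dx - of_real u * y * dq') = u\<^sup>2 * norm dx * N"
      by (simp add: N_def norm_mult norm_power)
    have "0 < u ^ 3 * R" and lt: "u\<^sup>2 * norm dx * N / (2 * (u ^ 3 * R)) < norm dx / (2 * u)"
      using strict0[OF uy] unfolding R N by simp_all
    hence R0: "0 < R" using u by (simp add: zero_less_mult_iff)
    have "u\<^sup>2 * norm dx * N / (2 * (u ^ 3 * R)) = norm dx / (2 * u) * (N / R)"
      using u by (simp add: power2_eq_square power3_eq_cube)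
    with lt have "norm dx / (2 * u) * (N / R) < norm dx / (2 * u) * 1" by simp
    hence "N / R < 1" using u dx by (subst (asm) mult_less_cancel_left_pos) auto
    hence "N < R" using R0 by simp
    thus ?thesis by (simp only: N_def R_def y_def)
  qed

  \<comment> \<open>Transfer of \<psi> to the symmetrized half-plane\<close>
  define X Q where "X = (\<lambda>h::complex \<times> complex. of_real u * fst h + \<i> * of_real t)"
    and "Q = (\<lambda>h::complex \<times> complex. of_real (u\<^sup>2) * snd h)"
  define F where "F = (\<lambda>h. \<psi> (hp_inverse \<omega> (X h, Q h)))"
  have XQ: "(X h, Q h) \<in> sym_half_plane" if "h \<in> sym_half_plane" for h
    using sym_half_plane_affine[of "fst h" "snd h" u t] that u by (simp add: X_def Q_def)
  have F: "F \<in> disc_maps sym_half_plane"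
  proof -
    have "complex_diff F h" if h: "h \<in> sym_half_plane" for h
    proof -
      have "(X h + 1)\<^sup>2 - Q h \<noteq> 0"
        using sym_half_plane_factor[OF XQ[OF h]] by (metis mult_eq_0_iff)
      moreover have "complex_diff X h" "complex_diff Q h"
        unfolding X_def Q_def by (intro complex_diff_rules)+
      ultimately have "complex_diff (\<lambda>h. 2 * ((X h)\<^sup>2 - Q h - 1) / (\<omega> * ((X h + 1)\<^sup>2 - Q h))) h"
        "complex_diff (\<lambda>h. ((X h - 1)\<^sup>2 - Q h) / (\<omega>\<^sup>2 * ((X h + 1)\<^sup>2 - Q h))) h"
        using \<omega>(2) by (auto intro!: complex_diff_rules)
      moreover have "complex_diff \<psi> (hp_inverse \<omega> (X h, Q h))"
        using \<psi> hp_inverse_in_symmetrized_bidisc[OF \<omega>(1) XQ[OF h]]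
        by (auto simp: disc_maps_def holomorphic2_on_iff)
      ultimately show ?thesis
        unfolding F_def hp_inverse_def fst_conv snd_conv by (intro complex_diff_compose2)
    qed
    moreover have "F h \<in> ball 0 1" if "h \<in> sym_half_plane" for h
      using \<psi> hp_inverse_in_symmetrized_bidisc[OF \<omega>(1) XQ[OF that]]
      unfolding disc_maps_def F_def by blast
    ultimately show ?thesis by (auto simp: disc_maps_def holomorphic2_on_iff)
  qed
  then obtain A B where dF: "(F has_derivative (\<lambda>h. A * fst h + B * snd h)) (at (1, q))"
    using base unfolding disc_maps_def holomorphic2_on_def by blast
  \<comment> \<open>\<open>F\<close> is \<psi> in normalized coordinates, and \<open>G\<close> is
    \<psi> in the original half-plane coordinates, to which the chain rule at \<open>p\<close>
    applies.\<close>
  define G where "G = (\<lambda>h. F ((fst h - \<i> * of_real t) / of_real u, snd h / of_real (u\<^sup>2)))"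
  have \<psi>G: "\<psi> x = G (hp_mean \<omega> x, hp_disc \<omega> x)" if "x \<in> symmetrized_bidisc" for x
    using hp_inverse_hp_coords[OF \<omega>(2) hp_den_nz[OF \<omega>(1) that]] u by (simp add: G_def F_def X_def Q_def)
  have "((\<lambda>h. ((fst h - \<i> * of_real t) / of_real u, snd h / of_real (u\<^sup>2))) has_derivative
      (\<lambda>h. (fst h / of_real u, snd h / of_real (u\<^sup>2)))) (at (a, q'))" (is "(?N has_derivative _) _")
    by (intro has_derivative_Pair bounded_linear.has_derivative[OF bounded_linear_divide])
       (auto intro!: derivative_eq_intros)
  moreover have "(F has_derivative (\<lambda>h. A * fst h + B * snd h)) (at (?N (a, q')))"
    using dF by (simp only: fst_conv snd_conv a1 q_def[symmetric])
  ultimately have "((\<lambda>h. F (?N h)) has_derivative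
      (\<lambda>h. A * (fst h / of_real u) + B * (snd h / of_real (u\<^sup>2)))) (at (a, q'))"
    by (auto dest: has_derivative_compose)
  hence dG: "(G has_derivative (\<lambda>h. A / of_real u * fst h + B / of_real (u\<^sup>2) * snd h))
      (at (hp_mean \<omega> p, hp_disc \<omega> p))"
    by (simp add: G_def flip: a_def q'_def)
  note mc = complex_diff_hp_coords[OF \<omega>(1) p]
  have GC: "complex_diff (\<lambda>x. G (hp_mean \<omega> x, hp_disc \<omega> x)) p"
    by (rule complex_diff_compose2[OF _ mc]) (use dG in \<open>unfold complex_diff_def, blast\<close>)
  have "directional_deriv v \<psi> p = directional_deriv v (\<lambda>x. G (hp_mean \<omega> x, hp_disc \<omega> x)) p"
    by (rule directional_deriv_cong_open[OF open_symmetrized_bidisc p \<psi>G GC])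
  also have "\<dots> = A / of_real u * dx + B / of_real (u\<^sup>2) * dq'"
    unfolding directional_deriv_compose2[OF dG mc] dx_def dq'_def ..
  also have "\<dots> = dx / of_real u * (A + B * dq)"
    using dx u by (simp add: dq_def field_simps power2_eq_square)
  finally have "norm (directional_deriv v \<psi> p) = norm dx / u * norm (A + B * dq)"
    using u by (simp add: norm_mult norm_divide)
  moreover have "\<psi> p = F (1, q)"
    using \<psi>G[OF p] a1 by (simp add: G_def q_def flip: a_def q'_def)
  \<comment> \<open>Both functions attain the same supremum; cancelling \<open>norm dx / u\<close>
    below yields \<open>ext\<close>.\<close>
  moreover have "car_quotient \<psi> \<delta> = norm dx / (2 * u)"
    using solves_CarD(2)[OF assms(5)] solves_CarD(2)[OF assms(6)] Phi\<omega> by (metis ereal.inject)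
  ultimately have "norm dx / u * (norm (A + B * dq) / (1 - (norm (F (1, q)))\<^sup>2)) = norm dx / u * (1 / 2)"
    by (simp add: car_quotient_def \<delta>)
  hence "norm (A + B * dq) / (1 - (norm (F (1, q)))\<^sup>2) = 1 / 2"
    by (rule mult_left_cancel[THEN iffD1, rotated]) (use dx u in simp)
  moreover have "1 - (norm (F (1, q)))\<^sup>2 \<noteq> 0"
  proof -
    have "norm (F (1, q)) < 1" using F base by (auto simp: disc_maps_def)
    hence "(norm (F (1, q)))\<^sup>2 < 1" by (simp add: abs_square_less_1)
    thus ?thesis by linarith
  qed
  ultimately have ext: "2 * norm (A + B * dq) = 1 - (norm (F (1, q)))\<^sup>2"
    by (simp add: divide_eq_eq)
  obtain c w where cw: "norm c = 1" "norm w < 1"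
    "\<And>x y. (x, y) \<in> sym_half_plane \<Longrightarrow> F (x, y) = Moebius_function 0 w (c * ((x - 1) / (x + 1)))"
    using extremal_depends_on_fst[OF F base dF ext strict] by blast

  \<comment> \<open>Construction of the automorphism\<close>
  define k Z0 where "k = (1 + a) / (1 + cnj a)" and "Z0 = (1 - a) / (1 + a)"
  \<comment> \<open>With \<open>s = hp_mean \<omega> x\<close>, the Cayley transform of the
    normalized coordinate is \<open>(s - a) / (s + cnj a)\<close>. This is \<open>- k\<close> times
    the Moebius map for \<open>Z0\<close> at
    \<open>(1 - s) / (1 + s) = \<omega> * Phi \<omega> x\<close>; \<open>m\<close> substitutes it
    into the formula for \<open>F\<close>.\<close>
  define m where "m = (\<lambda>z. Moebius_function 0 w ((c * - k) * Moebius_function 0 Z0 (\<omega> * z)))"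
  have "0 < Re a" using u by (simp add: u_def)
  have "norm Z0 = norm ((a - 1) / (a + 1))"
    by (simp add: Z0_def norm_divide norm_minus_commute add.commute)
  also have "\<dots> < 1" by (rule cayley_in_disc) fact
  finally have "norm Z0 < 1" .
  have "norm (1 + cnj a) = norm (1 + a)" by (metis complex_cnj_add complex_cnj_one complex_mod_cnj)
  moreover have "1 + a \<noteq> 0" using \<open>0 < Re a\<close> by (auto simp: complex_eq_iff)
  ultimately have "norm (c * - k) = 1" using cw by (simp add: k_def norm_mult norm_divide)
  hence "disc_automorphism m"
    unfolding m_def using \<open>norm Z0 < 1\<close> cw(2) \<omega>(1)
    by (intro disc_automorphism_compose[OF disc_automorphism_Moebius]
        disc_automorphism_compose[OF disc_automorphism_rotation[of "c * - k"]]
        disc_automorphism_compose[OF disc_automorphism_Moebius disc_automorphism_rotation])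
  moreover have "\<psi> x = m (Phi \<omega> x)" if x: "x \<in> symmetrized_bidisc" for x
  proof -
    define s where "s = hp_mean \<omega> x"
    have s: "0 < Re s" using Re_hp_mean_pos[OF \<omega>(1) x] by (simp add: s_def)
    have "\<psi> x = F ((s - \<i> * of_real t) / of_real u, hp_disc \<omega> x / of_real (u\<^sup>2))"
      by (simp add: \<psi>G[OF x] G_def s_def)
    also have "\<dots> = Moebius_function 0 w (c * (((s - \<i> * of_real t) / of_real u - 1) /
        ((s - \<i> * of_real t) / of_real u + 1)))"
      using hp_coords_in_sym_half_plane[OF \<omega>(1) x] by (intro cw normalize) (simp add: s_def)
    also have "(s - \<i> * of_real t) / of_real u - 1 = (s - a) / of_real u"
      using u by (simp add: a diff_divide_distrib add_divide_distrib)
    also have "(s - \<i> * of_real t) / of_real u + 1 = (s + cnj a) / of_real u"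
      using u by (simp add: a diff_divide_distrib add_divide_distrib)
    also have "(s - a) / of_real u / ((s + cnj a) / of_real u) = (s - a) / (s + cnj a)"
      using u by simp
    also have "(s - a) / (s + cnj a) = - k * Moebius_function 0 Z0 ((1 - s) / (1 + s))"
      using cayley_difference_as_Moebius[OF \<open>0 < Re a\<close> s] by (simp add: k_def Z0_def)
    also have "(1 - s) / (1 + s) = \<omega> * Phi \<omega> x"
    proof -
      have "\<omega> * cnj \<omega> = 1" using \<omega>(1) complex_norm_square[of \<omega>] by simp
      thus ?thesis
        unfolding Phi_eq_cayley_hp_mean[OF \<omega>(1) x] s_def mult.assoc[symmetric] by simp
    qed
    finally show ?thesis by (simp add: m_def mult.assoc)
  qed
  ultimately show ?thesis by blast
qed

end
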